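(* Let $\{e^{-i\theta T}\}_\theta$ be a finite-dimensional representation of the unitary group $U(1)$ with a Hermitian generator $T$, and let $\mathcal{U}^\theta$ be the channel corresponding to the unitary $e^{-i\theta T}$, i.e. $\mathcal{U}^\theta(\rho)=e^{-i\theta T}\rho\, e^{i\theta T}$. Then, for any $\theta$-dependent channel $\mathcal{C}^\theta$, $$\max_{\rho,\theta}F[\mathcal{C}^\theta(\rho)]\ \geq\ \min_\theta\left[1-8\,\mathrm{d}(\mathcal{C}^\theta,\mathcal{U}^\theta)^2\right](\Delta T)^2,$$ where the maximum on the left is over input states $\rho$ and parameter values $\theta$, $F$ is the quantum Fisher information with respect to $\theta$, $\mathrm{d}$ is the Bures distance between channels, and $\Delta T$ is the difference between the maximal and minimal eigenvalues of $T$.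
   Context: A channel is a completely positive trace-preserving linear map on operators on a finite-dimensional Hilbert space; a state is a density operator. The parameter $\theta$ ranges over $[0,2\pi]$. A $\theta$-dependent channel $\mathcal{C}^\theta$ is a family of channels, indexed by $\theta$, on the same system on which $T$ acts; no covariance of $\mathcal{C}^\theta$ is assumed. Quantum Fisher information (QFI): for a family of states $\rho^\theta$ (differentiable in $\theta$), $F(\rho^\theta)=\mathrm{Tr}[\rho^\theta(L^\theta)^2]$, where the operator $L^\theta$ (symmetric logarithmic derivative) is defined implicitly by $\dot\rho^\theta=\frac12(\rho^\theta L^\theta+L^\theta\rho^\theta)$, with $\dot\rho^\theta$ the derivative of $\rho^\theta$ with respect to $\theta$. $F[\mathcal{C}^\theta(\rho)]$ is the QFI, at the point $\theta$, of the family $\theta\mapsto\mathcal{C}^\theta(\rho)$ with $\rho$ fixed. Bures distance of channels: $\mathrm{d}(\mathcal{C},\mathcal{D})=\sqrt{1-\mathcal{F}(\mathcal{C},\mathcal{D})}$, where $\mathcal{F}(\mathcal{C},\mathcal{D})=\min_{|\Phi\rangle}f\big[\mathcal{C}\otimes\mathrm{id}(|\Phi\rangle\langle\Phi|),\mathcal{D}\otimes\mathrm{id}(|\Phi\rangle\langle\Phi|)\big]$ is the worst-case entanglement fidelity, with the minimum over all pure states $|\Phi\rangle$ of the system together with a reference system, and $f(\rho,\sigma)=\mathrm{Tr}\sqrt{\sqrt\rho\,\sigma\sqrt\rho}$.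
   Formalization: The θ-dependent channel is also assumed to close up, C^0 = C^{2π}; without this the claim fails, e.g. T = diag(0,1), C^θ = U^{π+0.9(θ−π)} has QFI at most 0.81 while the right side exceeds 0.90. *)

theory Defs
  imports
    Complex_Main
    "HOL-Library.Extended_Real"
    "Jordan_Normal_Form.Schur_Decomposition"
    "Jordan_Normal_Form.Spectral_Radius"
begin

text \<open>Operators on an n-dimensional Hilbert space are elements of
  \<^term>\<open>carrier_mat n n\<close> over the complex numbers.\<close>

definition mat_trace :: "complex mat \<Rightarrow> complex" where
  "mat_trace A = (\<Sum>i<dim_row A. A $$ (i, i))"

definition hermitian_mat :: "nat \<Rightarrow> complex mat \<Rightarrow> bool" where
  "hermitian_mat n A \<longleftrightarrow> A \<in> carrier_mat n n \<and> mat_adjoint A = A"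

definition unitary_mat :: "nat \<Rightarrow> complex mat \<Rightarrow> bool" where
  "unitary_mat n A \<longleftrightarrow>
     A \<in> carrier_mat n n \<and> mat_adjoint A * A = 1\<^sub>m n \<and> A * mat_adjoint A = 1\<^sub>m n"

text \<open>The order on the complex numbers is the one of \<^theory>\<open>HOL-Library.Complex_Order\<close>, so
  the inequality below also says that the quadratic form is real.\<close>

definition psd_mat :: "nat \<Rightarrow> complex mat \<Rightarrow> bool" where
  "psd_mat n A \<longleftrightarrow>
     A \<in> carrier_mat n n \<and> (\<forall>v\<in>carrier_vec n. 0 \<le> (A *\<^sub>v v) \<bullet>c v)"

definition density_operator :: "nat \<Rightarrow> complex mat \<Rightarrow> bool" where
  "density_operator n \<rho> \<longleftrightarrow> psd_mat n \<rho> \<and> mat_trace \<rho> = 1"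

definition mat_exp :: "complex mat \<Rightarrow> complex mat" where
  "mat_exp A = mat (dim_row A) (dim_row A)
     (\<lambda>(i, j). \<Sum>k. (A ^\<^sub>m k) $$ (i, j) / fact k)"

definition psd_sqrt :: "complex mat \<Rightarrow> complex mat" where
  "psd_sqrt A = (THE S. psd_mat (dim_row A) S \<and> S * S = A)"


text \<open>Bipartite operators: the basis vector $e_i \otimes e_a$ of the tensor product of an
  n-dimensional system and an m-dimensional reference has index \<open>i * m + a\<close>.
  \<open>ref_block n m X a b\<close> is the system operator obtained by sandwiching \<open>X\<close> between the reference
  basis vectors $e_a$ and $e_b$, and \<open>ext_id n m E\<close> is the map $E \otimes \mathrm{id}$.\<close>

definition ref_block :: "nat \<Rightarrow> nat \<Rightarrow> complex mat \<Rightarrow> nat \<Rightarrow> nat \<Rightarrow> complex mat" where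
  "ref_block n m X a b = mat n n (\<lambda>(i, j). X $$ (i * m + a, j * m + b))"

definition ext_id ::
  "nat \<Rightarrow> nat \<Rightarrow> (complex mat \<Rightarrow> complex mat) \<Rightarrow> complex mat \<Rightarrow> complex mat" where
  "ext_id n m E X = mat (n * m) (n * m)
     (\<lambda>(r, s). E (ref_block n m X (r mod m) (s mod m)) $$ (r div m, s div m))"

definition linear_superop :: "nat \<Rightarrow> (complex mat \<Rightarrow> complex mat) \<Rightarrow> bool" where
  "linear_superop n E \<longleftrightarrow>
     (\<forall>X\<in>carrier_mat n n. E X \<in> carrier_mat n n) \<and>
     (\<forall>X\<in>carrier_mat n n. \<forall>Y\<in>carrier_mat n n. E (X + Y) = E X + E Y) \<and>
     (\<forall>c. \<forall>X\<in>carrier_mat n n. E (c \<cdot>\<^sub>m X) = c \<cdot>\<^sub>m E X)"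

definition completely_positive :: "nat \<Rightarrow> (complex mat \<Rightarrow> complex mat) \<Rightarrow> bool" where
  "completely_positive n E \<longleftrightarrow>
     (\<forall>m X. psd_mat (n * m) X \<longrightarrow> psd_mat (n * m) (ext_id n m E X))"

definition channel :: "nat \<Rightarrow> (complex mat \<Rightarrow> complex mat) \<Rightarrow> bool" where
  "channel n E \<longleftrightarrow>
     linear_superop n E \<and> completely_positive n E \<and>
     (\<forall>X\<in>carrier_mat n n. mat_trace (E X) = mat_trace X)"


definition fidelity :: "complex mat \<Rightarrow> complex mat \<Rightarrow> real" where
  "fidelity \<rho> \<sigma> = Re (mat_trace (psd_sqrt (psd_sqrt \<rho> * \<sigma> * psd_sqrt \<rho>)))"

definition pure_state :: "complex vec \<Rightarrow> complex mat" where
  "pure_state v = mat (dim_vec v) (dim_vec v) (\<lambda>(i, j). v $ i * cnj (v $ j))"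

text \<open>The infimum runs over all pure states with a reference of any finite dimension; it is a
  minimum, attained with a reference of dimension \<open>n\<close>.\<close>

definition channel_fidelity ::
  "nat \<Rightarrow> (complex mat \<Rightarrow> complex mat) \<Rightarrow> (complex mat \<Rightarrow> complex mat) \<Rightarrow> real" where
  "channel_fidelity n C D =
     Inf {fidelity (ext_id n m C (pure_state v)) (ext_id n m D (pure_state v)) | m v.
            m > 0 \<and> v \<in> carrier_vec (n * m) \<and> v \<bullet>c v = 1}"

definition bures_distance ::
  "nat \<Rightarrow> (complex mat \<Rightarrow> complex mat) \<Rightarrow> (complex mat \<Rightarrow> complex mat) \<Rightarrow> real" where
  "bures_distance n C D = sqrt (1 - channel_fidelity n C D)"


definition has_mat_derivative ::
  "nat \<Rightarrow> (real \<Rightarrow> complex mat) \<Rightarrow> complex mat \<Rightarrow> real filter \<Rightarrow> bool" where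
  "has_mat_derivative n f D F \<longleftrightarrow>
     D \<in> carrier_mat n n \<and>
     (\<forall>i<n. \<forall>j<n. ((\<lambda>t. f t $$ (i, j)) has_vector_derivative D $$ (i, j)) F)"

text \<open>\<open>has_qfi n f S \<theta> q\<close>: the quantum Fisher information at \<open>\<theta>\<close> of the family \<open>f\<close> of states with
  parameter range \<open>S\<close> is \<open>q\<close>. The symmetric logarithmic derivative \<open>L\<close> is unique only up to
  its compression to $\ker f(\theta)$, but \<open>q\<close> does not depend on its choice. For a differentiable family of
  states, \<open>L\<close> exists at every interior point of an interval \<open>S\<close>; where the derivative is one-sided
  and the state is not of full rank, it may fail to exist, and then no \<open>q\<close> is related.\<close>

definition has_qfi ::
  "nat \<Rightarrow> (real \<Rightarrow> complex mat) \<Rightarrow> real set \<Rightarrow> real \<Rightarrow> real \<Rightarrow> bool" where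
  "has_qfi n f S \<theta> q \<longleftrightarrow>
     (\<exists>D L. has_mat_derivative n f D (at \<theta> within S) \<and> L \<in> carrier_mat n n \<and>
            D = (1 / 2) \<cdot>\<^sub>m (f \<theta> * L + L * f \<theta>) \<and>
            q = Re (mat_trace (f \<theta> * (L * L))))"


text \<open>A unitary representation of U(1), the latter being the complex numbers of modulus 1.\<close>

definition unitary_rep_U1 :: "nat \<Rightarrow> (complex \<Rightarrow> complex mat) \<Rightarrow> bool" where
  "unitary_rep_U1 n R \<longleftrightarrow>
     (\<forall>z. cmod z = 1 \<longrightarrow> unitary_mat n (R z)) \<and>
     (\<forall>z w. cmod z = 1 \<longrightarrow> cmod w = 1 \<longrightarrow> R (z * w) = R z * R w)"

definition phase_unitary :: "complex mat \<Rightarrow> real \<Rightarrow> complex mat" where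
  "phase_unitary T \<theta> = mat_exp ((- \<i> * of_real \<theta>) \<cdot>\<^sub>m T)"

definition phase_channel :: "complex mat \<Rightarrow> real \<Rightarrow> complex mat \<Rightarrow> complex mat" where
  "phase_channel T \<theta> \<rho> =
     phase_unitary T \<theta> * \<rho> * mat_exp ((\<i> * of_real \<theta>) \<cdot>\<^sub>m T)"

definition eigenvalue_spread :: "complex mat \<Rightarrow> real" where
  "eigenvalue_spread T = Max (Re ` spectrum T) - Min (Re ` spectrum T)"

end

theory Submission
  imports Defs
begin

text \<open>Take the input \<open>\<psi> = (v + w) / \<surd>2\<close>, where \<open>v\<close> and \<open>w\<close> are unit eigenvectors of \<open>T\<close> for the
  extremal eigenvalues, whose difference is \<open>\<Delta>\<close>, and follow the coherence
  \<open>c(\<theta>) = \<langle>v| C\<^sup>\<theta>(\<psi>) |w\<rangle>\<close>. Closeness of \<open>C\<^sup>\<theta>\<close> to the ideal channel forces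
  \<open>g(\<theta>) = exp (i \<theta> \<Delta>) c(\<theta>)\<close> to have real part at least \<open>1/2 - 2 d\<^sup>2\<close>. If this is positive, then
  \<open>Im g / Re g\<close> is defined and takes equal values at \<open>0\<close> and \<open>2\<pi>\<close>, so by Rolle's theorem \<open>g\<close> moves
  purely radially at some interior \<open>\<theta>\<close>; there \<open>c\<close> rotates with angular velocity exactly \<open>-\<Delta>\<close>.
  Testing the variational bound \<open>F \<ge> 2 Tr (\<rho>' K) - Tr (\<rho> K\<^sup>2)\<close> with a Hermitian \<open>K\<close> supported on the
  span of \<open>v\<close> and \<open>w\<close> gives \<open>F \<ge> 4 \<bar>c\<bar>\<^sup>2 \<Delta>\<^sup>2 \<ge> (1 - 4 d\<^sup>2)\<^sup>2 \<Delta>\<^sup>2 \<ge> (1 - 8 d\<^sup>2) \<Delta>\<^sup>2\<close>.\<close>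

section \<open>Diagonalization of Hermitian matrices\<close>

text \<open>The condition \<open>C 0 \<rho> = C (2 * pi) \<rho>\<close> shapes the proof. A channel
  rotating slightly too slowly, by (1 - eps) \<theta>, has d^2 of order eps^2 only, yet loses Fisher
  information to first order in eps; closeness alone cannot control the angular velocity. A closed
  curve can: g is the coherence in the frame rotating with the ideal evolution, and a closed curve
  in a half plane does not wind around 0, so at some instant its argument stands still. The constant
  2 d^2 has two sources: the squared fidelity is at least (1 - d^2)^2 >= 1 - 2 d^2, and the
  populations of v and w contribute at most 1/2 to the overlap with the ideal output. Bounding F
  variationally means that the symmetric logarithmic derivative, which depends on the spectral
  decomposition of the state, only has to exist. Its existence is derived at interior parameters,
  and Rolle's theorem supplies exactly such a point. If the right-hand side is not positive, some
  Fisher information must still be exhibited, because the supremum of the empty set of extended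
  reals is minus infinity.\<close>

lemma mult_carrier_mat_square [simp]:
  "A \<in> carrier_mat n n \<Longrightarrow> B \<in> carrier_mat n n \<Longrightarrow> A * B \<in> carrier_mat n n"
  by auto

lemma mult_mat_vec_square [simp]:
  "A \<in> carrier_mat n n \<Longrightarrow> v \<in> carrier_vec n \<Longrightarrow> A *\<^sub>v v \<in> carrier_vec n"
  by auto

lemma assoc_mat_dim:
  "dim_col A = dim_row B \<Longrightarrow> dim_col B = dim_row C \<Longrightarrow> A * B * C = A * (B * C)"
  for A B C :: "'a :: semiring_0 mat"
  by (rule assoc_mult_mat[of _ "dim_row A" "dim_row B" _ "dim_row C" _ "dim_col C"]) (rule carrier_matI; simp)+

lemma dim_mat_diag [simp]: "dim_row (mat_diag n f) = n" "dim_col (mat_diag n f) = n"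
  by (simp_all add: mat_diag_def)

lemma mat_adjoint_dim [simp]:
  "dim_row (mat_adjoint A) = dim_col A" "dim_col (mat_adjoint A) = dim_row A"
  by (auto simp: mat_adjoint_def)

lemma mat_adjoint_carrier [simp, intro]:
  "A \<in> carrier_mat m n \<Longrightarrow> mat_adjoint A \<in> carrier_mat n m"
  by (intro carrier_matI) auto

lemma mat_adjoint_index [simp]:
  fixes A :: "complex mat"
  shows "i < dim_col A \<Longrightarrow> j < dim_row A \<Longrightarrow> mat_adjoint A $$ (i, j) = cnj (A $$ (j, i))"
  by (auto simp: mat_adjoint_def mat_of_rows_index)

lemma mat_mult_index:
  assumes "A \<in> carrier_mat m n" "B \<in> carrier_mat n p" "i < m" "j < p"
  shows "(A * B) $$ (i, j) = (\<Sum>k<n. A $$ (i, k) * B $$ (k, j))"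
  using assms by (auto simp: scalar_prod_def atLeast0LessThan)

lemma mat_adjoint_mult:
  fixes A B :: "complex mat"
  assumes "A \<in> carrier_mat m n" "B \<in> carrier_mat n p"
  shows "mat_adjoint (A * B) = mat_adjoint B * mat_adjoint A"
proof (rule eq_matI)
  fix i j assume "i < dim_row (mat_adjoint B * mat_adjoint A)" "j < dim_col (mat_adjoint B * mat_adjoint A)"
  then have ij: "i < p" "j < m" using assms by auto
  then show "mat_adjoint (A * B) $$ (i, j) = (mat_adjoint B * mat_adjoint A) $$ (i, j)"
    using assms ij
    by (auto simp: scalar_prod_def mult.commute intro!: sum.cong)
qed (use assms in auto)

lemma mat_adjoint_adjoint [simp]: "mat_adjoint (mat_adjoint A) = (A :: complex mat)"
  by (rule eq_matI) auto

lemma cscalar_prod_sum: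
  fixes v w :: "complex vec"
  assumes "w \<in> carrier_vec n"
  shows "v \<bullet>c w = (\<Sum>i<n. v $ i * cnj (w $ i))"
  using assms by (auto simp: scalar_prod_def atLeast0LessThan)

text \<open>Gram-Schmidt on a basis that starts with \<open>v\<close> keeps \<open>v\<close> in
  front; dividing each vector by its norm gives the columns of \<open>W\<close>, and
  \<open>c\<close> is the normalization of \<open>v\<close>. This is the deflation step of the
  diagonalization.\<close>

lemma unitary_first_column_exists:
  fixes v :: "complex vec"
  assumes v: "v \<in> carrier_vec n" and v0: "v \<noteq> 0\<^sub>v n" and n: "n > 0"
  shows "\<exists>W c. unitary_mat n W \<and> col W 0 = c \<cdot>\<^sub>v v"
proof -
  interpret cof_vec_space n "TYPE(complex)" .
  define b where "b = basis_completion v"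
  from basis_completion[OF v v0, folded b_def]
  have dist_b: "distinct b"
    and indep: "\<not> lin_dep (set b)" and b: "set b \<subseteq> carrier_vec n" and hdb: "hd b = v"
    and len_b: "length b = n" by auto
  from hdb len_b n obtain vs where bv: "b = v # vs" by (cases b, auto)
  define ws where "ws = gram_schmidt n b"
  from gram_schmidt_result[OF b dist_b indep refl, folded ws_def]
  have ws: "set ws \<subseteq> carrier_vec n" "corthogonal ws" "length ws = n"
    by (auto simp: len_b)
  have "hd ws = v" using gram_schmidt_hd[OF v, of vs] unfolding ws_def bv by simp
  then have ws0: "ws ! 0 = v" using ws(3) n by (cases ws) auto
  have orth: "ws ! i \<bullet>c ws ! j = 0 \<longleftrightarrow> i \<noteq> j" if "i < n" "j < n" for i j
    using ws(2) that ws(3) by (auto simp: corthogonal_def)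
  have wsc: "ws ! i \<in> carrier_vec n" if "i < n" for i using ws that by auto
  define r where "r = (\<lambda>i. sqrt (Re (ws ! i \<bullet>c ws ! i)))"
  have rr: "ws ! i \<bullet>c ws ! i = of_real (r i) * of_real (r i)" and r0: "r i \<noteq> 0" if "i < n" for i
  proof -
    have ge: "0 \<le> ws ! i \<bullet>c ws ! i" by (rule conjugate_square_ge_0_vec)
    then have re: "ws ! i \<bullet>c ws ! i = of_real (Re (ws ! i \<bullet>c ws ! i))" "Re (ws ! i \<bullet>c ws ! i) \<ge> 0"
      by (auto simp: less_eq_complex_def complex_eq_iff)
    show *: "ws ! i \<bullet>c ws ! i = of_real (r i) * of_real (r i)"
      using re by (simp add: r_def flip: of_real_mult)
    show "r i \<noteq> 0" using * orth[OF that that] by auto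
  qed
  define W where "W = mat n n (\<lambda>(i, j). ws ! j $ i / of_real (r j))"
  have W: "W \<in> carrier_mat n n" by (simp add: W_def)
  have WW: "mat_adjoint W * W = 1\<^sub>m n"
  proof (rule eq_matI)
    fix i j assume "i < dim_row (1\<^sub>m n :: complex mat)" "j < dim_col (1\<^sub>m n :: complex mat)"
    then have ij: "i < n" "j < n" by auto
    have "(mat_adjoint W * W) $$ (i, j) = (\<Sum>k<n. cnj (ws ! i $ k) * ws ! j $ k / (of_real (r i) * of_real (r j)))"
      using W ij by (subst mat_mult_index[of _ n n]) (auto simp: W_def)
    also have "\<dots> = (ws ! j \<bullet>c ws ! i) / (of_real (r i) * of_real (r j))"
      using wsc[OF ij(1)] by (simp add: cscalar_prod_sum sum_divide_distrib mult.commute)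
    also have "\<dots> = (if i = j then 1 else 0)"
      using orth[OF ij(2,1)] rr[OF ij(1)] r0[OF ij(1)] by auto
    finally show "(mat_adjoint W * W) $$ (i, j) = 1\<^sub>m n $$ (i, j)" using ij by simp
  qed (use W in auto)
  have "W * mat_adjoint W = 1\<^sub>m n"
    by (rule mat_mult_left_right_inverse[OF _ W WW]) (use W in auto)
  moreover have "col W 0 = (1 / of_real (r 0)) \<cdot>\<^sub>v v"
    by (rule eq_vecI) (use n v ws0 in \<open>auto simp: W_def\<close>)
  ultimately show ?thesis using W WW unfolding unitary_mat_def by blast
qed

lemma unitary_mat_adjoint: "unitary_mat n U \<Longrightarrow> unitary_mat n (mat_adjoint U)"
  by (auto simp: unitary_mat_def)

lemma unitary_mat_mult:
  assumes "unitary_mat n U" "unitary_mat n V"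
  shows "unitary_mat n (U * V)"
proof -
  have c: "U \<in> carrier_mat n n" "V \<in> carrier_mat n n"
    using assms by (auto simp: unitary_mat_def)
  have c': "mat_adjoint U \<in> carrier_mat n n" "mat_adjoint V \<in> carrier_mat n n" using c by auto
  have "mat_adjoint V * mat_adjoint U * (U * V) = mat_adjoint V * (mat_adjoint U * U) * V"
    using c c' by (simp add: assoc_mat_dim)
  also have "\<dots> = 1\<^sub>m n"
    using assms c' by (simp add: unitary_mat_def right_mult_one_mat[of _ n n])
  finally have 1: "mat_adjoint V * mat_adjoint U * (U * V) = 1\<^sub>m n" .
  have "U * V * (mat_adjoint V * mat_adjoint U) = U * (V * mat_adjoint V) * mat_adjoint U"
    using c c' by (simp add: assoc_mat_dim)
  also have "\<dots> = 1\<^sub>m n"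
    using assms c by (simp add: unitary_mat_def right_mult_one_mat[of _ n n])
  finally have 2: "U * V * (mat_adjoint V * mat_adjoint U) = 1\<^sub>m n" .
  show ?thesis using c 1 2 unfolding unitary_mat_def mat_adjoint_mult[OF c] by simp
qed

lemma hermitian_mat_index:
  assumes "hermitian_mat n A" "i < n" "j < n"
  shows "A $$ (i, j) = cnj (A $$ (j, i))"
  using assms mat_adjoint_index[of i A j] unfolding hermitian_mat_def by auto

lemma hermitian_matI:
  assumes "A \<in> carrier_mat n n" "\<And>i j. i < n \<Longrightarrow> j < n \<Longrightarrow> A $$ (i, j) = cnj (A $$ (j, i))"
  shows "hermitian_mat n A"
  unfolding hermitian_mat_def
proof
  show "mat_adjoint A = A"
  proof (rule eq_matI)
    fix i j assume "i < dim_row A" "j < dim_col A"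
    then show "mat_adjoint A $$ (i, j) = A $$ (i, j)"
      using assms(1) assms(2)[of j i] by (metis carrier_matD complex_cnj_cnj mat_adjoint_index)
  qed (use assms(1) in auto)
qed (rule assms(1))

lemma hermitian_conj:
  assumes "hermitian_mat n A" "W \<in> carrier_mat n n"
  shows "hermitian_mat n (W * A * mat_adjoint W)"
proof -
  have c: "A \<in> carrier_mat n n" "mat_adjoint W \<in> carrier_mat n n"
    using assms by (auto simp: hermitian_mat_def)
  have "mat_adjoint (W * A * mat_adjoint W) = W * (A * mat_adjoint W)"
    using assms c mat_adjoint_mult[of "W * A" n n "mat_adjoint W" n] mat_adjoint_mult[of W n n A n]
    by (auto simp: hermitian_mat_def)
  then show ?thesis using assms c
    by (auto simp: hermitian_mat_def assoc_mat_dim)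
qed

lemma unitary_conj_cancel:
  assumes "unitary_mat n W" "A \<in> carrier_mat n n"
  shows "W * (mat_adjoint W * A * W) * mat_adjoint W = A"
proof -
  have c: "W \<in> carrier_mat n n" "mat_adjoint W \<in> carrier_mat n n"
    using assms by (auto simp: unitary_mat_def)
  have "W * (mat_adjoint W * A * W) * mat_adjoint W = (W * mat_adjoint W) * A * (W * mat_adjoint W)"
    using assms(2) c by (simp add: assoc_mat_dim)
  then show ?thesis using assms by (simp add: unitary_mat_def)
qed

text \<open>Deflation by induction on the dimension. Conjugating by a unitary whose first column is
  an eigenvector clears the rest of the first column; being Hermitian clears the first row as well
  and makes the eigenvalue real, so a Hermitian block of size \<open>n\<close> remains.\<close>

theorem hermitian_diagonalization:
  assumes "hermitian_mat n A"
  shows "\<exists>U d. unitary_mat n U \<and> A = U * mat_diag n (\<lambda>i. of_real (d i)) * mat_adjoint U"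
  using assms
proof (induction n arbitrary: A)
  case 0
  then have "A = 1\<^sub>m 0 * mat_diag 0 (\<lambda>i. of_real 0) * mat_adjoint (1\<^sub>m 0)"
    by (intro eq_matI) (auto simp: hermitian_mat_def)
  then show ?case by (intro exI[of _ "1\<^sub>m 0"] exI[of _ "\<lambda>_. 0"]) (auto simp: unitary_mat_def intro!: eq_matI)
next
  case (Suc n)
  let ?n = "Suc n"
  have A: "A \<in> carrier_mat ?n ?n" using Suc.prems by (simp add: hermitian_mat_def)
  obtain e where "e \<in> spectrum A" using spectrum_non_empty[OF A] by auto
  then obtain v where v: "v \<in> carrier_vec ?n" "v \<noteq> 0\<^sub>v ?n" "A *\<^sub>v v = e \<cdot>\<^sub>v v"
    using A by (auto simp: spectrum_def eigenvalue_def eigenvector_def)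
  obtain W c where W: "unitary_mat ?n W" and col: "col W 0 = c \<cdot>\<^sub>v v"
    using unitary_first_column_exists[OF v(1,2)] by auto
  have Wc: "W \<in> carrier_mat ?n ?n" "mat_adjoint W \<in> carrier_mat ?n ?n"
    using W by (auto simp: unitary_mat_def)
  define B where "B = mat_adjoint W * A * W"
  have B: "B \<in> carrier_mat ?n ?n" using A Wc by (simp add: B_def)
  have hB: "hermitian_mat ?n B"
    using hermitian_conj[OF Suc.prems Wc(2)] by (simp add: B_def)
  have AB: "A = W * B * mat_adjoint W"
    using unitary_conj_cancel[OF W A] by (simp add: B_def)
  have colW: "col W 0 \<in> carrier_vec ?n" using Wc(1) col_dim[of W 0] by auto
  \<comment> \<open>The first column of \<open>W\<close> is a multiple of \<open>v\<close>, so
    \<open>A\<close> scales it by \<open>e\<close>, and the adjoint of \<open>W\<close> turns it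
    back into the first basis vector.\<close>
  have B0: "B $$ (i, 0) = (if i = 0 then e else 0)" if "i < ?n" for i
  proof -
    have "col B 0 = mat_adjoint W *\<^sub>v (A *\<^sub>v col W 0)"
      using A Wc colW by (simp add: B_def col_mult2[of _ ?n ?n _ ?n] assoc_mult_mat_vec[of _ ?n ?n _ ?n])
    also have "A *\<^sub>v col W 0 = c \<cdot>\<^sub>v (e \<cdot>\<^sub>v v)"
      using v A col by (simp add: mult_mat_vec[of _ ?n ?n])
    also have "\<dots> = e \<cdot>\<^sub>v col W 0" using col by (simp add: smult_smult_assoc mult.commute)
    also have "mat_adjoint W *\<^sub>v (e \<cdot>\<^sub>v col W 0) = e \<cdot>\<^sub>v (mat_adjoint W *\<^sub>v col W 0)"
      using Wc colW by (intro mult_mat_vec[of _ ?n ?n]) auto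
    also have "mat_adjoint W *\<^sub>v col W 0 = col (mat_adjoint W * W) 0"
      using Wc by (simp add: col_mult2[of _ ?n ?n _ ?n])
    also have "mat_adjoint W * W = 1\<^sub>m ?n" using W by (simp add: unitary_mat_def)
    finally have *: "col B 0 = e \<cdot>\<^sub>v col (1\<^sub>m ?n) 0" .
    have "B $$ (i, 0) = col B 0 $ i" using B that by simp
    also have "\<dots> = (if i = 0 then e else 0)" unfolding * using that by auto
    finally show ?thesis .
  qed
  have eR: "e = of_real (Re e)"
    using hermitian_mat_index[OF hB, of 0 0] B0[of 0] by (simp add: complex_eq_iff)
  define A3 where "A3 = mat n n (\<lambda>(i, j). B $$ (Suc i, Suc j))"
  have A3: "A3 \<in> carrier_mat n n" by (simp add: A3_def)
  have "hermitian_mat n A3"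
    by (rule hermitian_matI[OF A3]) (auto simp: A3_def intro: hermitian_mat_index[OF hB])
  then obtain V d where V: "unitary_mat n V" and A3V: "A3 = V * mat_diag n (\<lambda>i. of_real (d i)) * mat_adjoint V"
    using Suc.IH by blast
  have Vc: "V \<in> carrier_mat n n" "mat_adjoint V \<in> carrier_mat n n"
    using V by (auto simp: unitary_mat_def)
  \<comment> \<open>\<open>F a X\<close> is the direct sum of the scalar \<open>a\<close> and the
    block \<open>X\<close>. It respects products, adjoints and the identity, so the diagonalization
    of the smaller block lifts without computing entries.\<close>
  define F where "F = (\<lambda>a X. four_block_mat (a \<cdot>\<^sub>m 1\<^sub>m 1) (0\<^sub>m 1 n) (0\<^sub>m n 1) (X :: complex mat))"
  have FF: "F a X * F b Y = F (a * b) (X * Y)" if "X \<in> carrier_mat n n" "Y \<in> carrier_mat n n" for a b X Y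
    unfolding F_def using that
    by (subst mult_four_block_mat[of _ 1 1 _ n _ n _ _ 1 _ n])
       (auto intro!: cong_four_block_mat eq_matI)
  have Fadj: "mat_adjoint (F a X) = F (cnj a) (mat_adjoint X)" if "X \<in> carrier_mat n n" for a X
    unfolding F_def using that by (intro eq_matI) auto
  have F1: "F 1 (1\<^sub>m n) = 1\<^sub>m ?n"
    unfolding F_def by (intro eq_matI) auto
  have FC: "F a X \<in> carrier_mat ?n ?n" if "X \<in> carrier_mat n n" for a X
    unfolding F_def using that by auto
  have BF: "B = F e A3"
  proof (rule eq_matI)
    fix i j assume "i < dim_row (F e A3)" "j < dim_col (F e A3)"
    then have ij: "i < ?n" "j < ?n" using FC[OF A3, of e] by auto
    have Bj: "B $$ (0, j) = (if j = 0 then e else 0)"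
      using hermitian_mat_index[OF hB, of 0 j] B0[of j] ij eR
      by (cases "j = 0") (auto simp: complex_eq_iff)
    show "B $$ (i, j) = F e A3 $$ (i, j)"
      using ij B0[of i] Bj by (cases i; cases j) (auto simp: F_def A3_def)
  qed (use B FC[OF A3, of e] in auto)
  define d' where "d' = (\<lambda>i. case i of 0 \<Rightarrow> Re e | Suc k \<Rightarrow> d k)"
  have Fd: "mat_diag ?n (\<lambda>i. of_real (d' i)) = F e (mat_diag n (\<lambda>i. of_real (d i)))"
  proof (rule eq_matI)
    fix i j assume "i < dim_row (F e (mat_diag n (\<lambda>i. of_real (d i))))" "j < dim_col (F e (mat_diag n (\<lambda>i. of_real (d i))))"
    then have ij: "i < ?n" "j < ?n" using FC[of "mat_diag n (\<lambda>i. of_real (d i))" e] by auto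
    then show "mat_diag ?n (\<lambda>i. of_real (d' i)) $$ (i, j) = F e (mat_diag n (\<lambda>i. of_real (d i))) $$ (i, j)"
      using eR by (cases i; cases j) (auto simp: F_def mat_diag_def d'_def)
  qed (use FC[of "mat_diag n (\<lambda>i. of_real (d i))" e] in \<open>auto simp: mat_diag_def\<close>)
  define U where "U = W * F 1 V"
  have uF: "unitary_mat ?n (F 1 V)"
    using V Vc FC[OF Vc(1)] by (auto simp: unitary_mat_def Fadj FF F1)
  have U: "unitary_mat ?n U" unfolding U_def by (rule unitary_mat_mult[OF W uF])
  let ?D = "mat_diag ?n (\<lambda>i. of_real (d' i)) :: complex mat"
  let ?E = "mat_diag n (\<lambda>i. of_real (d i)) :: complex mat"
  have "B = F 1 V * ?D * mat_adjoint (F 1 V)"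
    using Vc FF[of V ?E 1 e] FF[of "V * ?E" "mat_adjoint V" e 1]
    unfolding BF A3V Fd by (simp add: Fadj)
  moreover have "W * (F 1 V * ?D * mat_adjoint (F 1 V)) * mat_adjoint W = U * ?D * mat_adjoint U"
    using Wc FC[OF Vc(1), of 1] mat_adjoint_carrier[OF FC[OF Vc(1), of 1]]
    by (simp add: U_def mat_adjoint_mult[of _ ?n ?n _ ?n] assoc_mat_dim)
  ultimately have "A = U * ?D * mat_adjoint U" using AB by simp
  with U show ?case by blast
qed

section \<open>Positive semidefinite matrices and fidelity\<close>

lemma of_real_cmod_square: "(complex_of_real (cmod z))\<^sup>2 = z * cnj z"
  by (metis complex_norm_square of_real_power)

text \<open>The Dirac matrix element, conjugate-linear in \<open>v\<close> and linear in
  \<open>w\<close>. The arguments change sides because \<open>\<bullet>c\<close> conjugates its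
  second argument.\<close>

definition sandwich :: "complex mat \<Rightarrow> complex vec \<Rightarrow> complex vec \<Rightarrow> complex" where
  "sandwich A v w = (A *\<^sub>v w) \<bullet>c v"

lemma sandwich_sum:
  assumes "A \<in> carrier_mat n n" "v \<in> carrier_vec n" "w \<in> carrier_vec n"
  shows "sandwich A v w = (\<Sum>i<n. \<Sum>j<n. A $$ (i, j) * w $ j * cnj (v $ i))"
  using assms
  by (auto simp: sandwich_def cscalar_prod_sum scalar_prod_def atLeast0LessThan sum_distrib_right
      intro!: sum.cong)

lemma sandwich_smult_mat:
  assumes "A \<in> carrier_mat n n" "v \<in> carrier_vec n" "w \<in> carrier_vec n"
  shows "sandwich (c \<cdot>\<^sub>m A) v w = c * sandwich A v w"
  using assms by (simp add: sandwich_sum[of _ n] sum_distrib_left algebra_simps)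

lemma sandwich_add_left:
  assumes "A \<in> carrier_mat n n" "v \<in> carrier_vec n" "u \<in> carrier_vec n" "w \<in> carrier_vec n"
  shows "sandwich A (u + v) w = sandwich A u w + sandwich A v w"
  using assms by (simp add: sandwich_sum[of _ n] algebra_simps sum.distrib)

lemma sandwich_add_right:
  assumes "A \<in> carrier_mat n n" "v \<in> carrier_vec n" "u \<in> carrier_vec n" "w \<in> carrier_vec n"
  shows "sandwich A v (u + w) = sandwich A v u + sandwich A v w"
  using assms by (simp add: sandwich_sum[of _ n] algebra_simps sum.distrib)

lemma sandwich_smult_left:
  assumes "A \<in> carrier_mat n n" "v \<in> carrier_vec n" "w \<in> carrier_vec n"
  shows "sandwich A (c \<cdot>\<^sub>v v) w = cnj c * sandwich A v w"
  using assms by (simp add: sandwich_sum[of _ n] sum_distrib_left algebra_simps)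

lemma sandwich_smult_right:
  assumes "A \<in> carrier_mat n n" "v \<in> carrier_vec n" "w \<in> carrier_vec n"
  shows "sandwich A v (c \<cdot>\<^sub>v w) = c * sandwich A v w"
  using assms by (simp add: sandwich_sum[of _ n] sum_distrib_left algebra_simps)

lemma sandwich_unit:
  assumes "A \<in> carrier_mat n n" "i < n" "j < n"
  shows "sandwich A (unit_vec n i) (unit_vec n j) = A $$ (i, j)"
  using assms
  by (simp add: sandwich_sum[of _ n] unit_vec_def if_distrib[of "\<lambda>x. _ * x"] if_distrib[of cnj] cong: if_cong)
     (subst sum.swap, simp)

text \<open>The polarization formula: the choices 1 and \<open>\<i>\<close> for \<open>c\<close>
  recover the off-diagonal entries from the quadratic form.\<close>

lemma sandwich_unit_combination:
  assumes "A \<in> carrier_mat n n" "i < n" "j < n"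
  shows "sandwich A (unit_vec n i + c \<cdot>\<^sub>v unit_vec n j) (unit_vec n i + c \<cdot>\<^sub>v unit_vec n j) =
     A $$ (i, i) + c * A $$ (i, j) + cnj c * A $$ (j, i) + c * cnj c * A $$ (j, j)"
  using assms by (simp add: sandwich_add_left[of _ n] sandwich_add_right[of _ n] sandwich_smult_left[of _ n]
      sandwich_smult_right[of _ n] sandwich_unit algebra_simps)

lemma sandwich_mult_right:
  assumes "A \<in> carrier_mat n n" "B \<in> carrier_mat n n" "v \<in> carrier_vec n" "w \<in> carrier_vec n"
  shows "sandwich (A * B) v w = sandwich A v (B *\<^sub>v w)"
  using assms unfolding sandwich_def by (simp add: assoc_mult_mat_vec[of _ n n _ n])

lemma cscalar_prod_adjoint:
  fixes A :: "complex mat"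
  assumes "A \<in> carrier_mat m n" "v \<in> carrier_vec m" "x \<in> carrier_vec n"
  shows "(A *\<^sub>v x) \<bullet>c v = x \<bullet>c (mat_adjoint A *\<^sub>v v)"
proof -
  have "(A *\<^sub>v x) \<bullet>c v = (\<Sum>i<m. \<Sum>j<n. A $$ (i, j) * x $ j * cnj (v $ i))"
    using assms by (auto simp: cscalar_prod_sum scalar_prod_def atLeast0LessThan sum_distrib_right
      intro!: sum.cong)
  also have "\<dots> = (\<Sum>j<n. \<Sum>i<m. A $$ (i, j) * x $ j * cnj (v $ i))" by (rule sum.swap)
  also have "\<dots> = x \<bullet>c (mat_adjoint A *\<^sub>v v)"
    using assms mult_mat_vec_carrier[OF mat_adjoint_carrier[OF assms(1)] assms(2)]
    by (subst cscalar_prod_sum[of _ n]) (auto simp: scalar_prod_def atLeast0LessThan sum_distrib_left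
      intro!: sum.cong)
  finally show ?thesis .
qed

lemma sandwich_mult_left:
  assumes "A \<in> carrier_mat n n" "B \<in> carrier_mat n n" "v \<in> carrier_vec n" "w \<in> carrier_vec n"
  shows "sandwich (A * B) v w = sandwich B (mat_adjoint A *\<^sub>v v) w"
  using assms cscalar_prod_adjoint[of A n n v "B *\<^sub>v w"]
  unfolding sandwich_def by (simp add: assoc_mult_mat_vec[of _ n n _ n])

lemma psd_mat_iff:
  "psd_mat n A \<longleftrightarrow> A \<in> carrier_mat n n \<and> (\<forall>v\<in>carrier_vec n. 0 \<le> sandwich A v v)"
  by (auto simp: psd_mat_def sandwich_def)

lemma psd_mat_carrier: "psd_mat n A \<Longrightarrow> A \<in> carrier_mat n n"
  by (simp add: psd_mat_def)

text \<open>In the order on the complex numbers a nonnegative value is real. Polarization with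
  \<open>c = 1\<close> and \<open>c = \<i>\<close> then relates the imaginary and the real parts of
  the two opposite entries.\<close>

lemma psd_mat_hermitian:
  assumes "psd_mat n A"
  shows "hermitian_mat n A"
proof (rule hermitian_matI)
  show A: "A \<in> carrier_mat n n" using assms by (rule psd_mat_carrier)
  have im: "Im (sandwich A v v) = 0" if "v \<in> carrier_vec n" for v
    using assms that by (auto simp: psd_mat_iff less_eq_complex_def)
  fix i j assume ij: "i < n" "j < n"
  have *: "Im (c * A $$ (i, j)) + Im (cnj c * A $$ (j, i)) = 0" if c: "c * cnj c = 1" for c
  proof -
    note sandwich_unit_combination[OF A ij, of c]
    moreover have "Im (A $$ (i, i)) = 0" "Im (A $$ (j, j)) = 0"
      using im[of "unit_vec n i"] im[of "unit_vec n j"] A ij by (simp_all add: sandwich_unit)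
    ultimately show ?thesis using im[of "unit_vec n i + c \<cdot>\<^sub>v unit_vec n j"] by (simp add: c)
  qed
  show "A $$ (i, j) = cnj (A $$ (j, i))"
    using *[of 1] *[of \<i>] by (simp add: complex_eq_iff)
qed

lemma psd_mat_conj:
  assumes "psd_mat n A" "W \<in> carrier_mat n n"
  shows "psd_mat n (W * A * mat_adjoint W)"
proof -
  have A: "A \<in> carrier_mat n n" using assms by (simp add: psd_mat_carrier)
  have W: "mat_adjoint W \<in> carrier_mat n n" using assms(2) by simp
  show ?thesis unfolding psd_mat_iff
  proof (intro conjI ballI)
    fix v :: "complex vec" assume v: "v \<in> carrier_vec n"
    have "sandwich (W * A * mat_adjoint W) v v = sandwich (W * (A * mat_adjoint W)) v v"
      using A assms(2) by (simp add: assoc_mat_dim)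
    also have "\<dots> = sandwich (A * mat_adjoint W) (mat_adjoint W *\<^sub>v v) v"
      using A W assms(2) v by (intro sandwich_mult_left[of _ n]) auto
    also have "\<dots> = sandwich A (mat_adjoint W *\<^sub>v v) (mat_adjoint W *\<^sub>v v)"
      using A W v by (intro sandwich_mult_right[of _ n]) auto
    finally have "sandwich (W * A * mat_adjoint W) v v = sandwich A (mat_adjoint W *\<^sub>v v) (mat_adjoint W *\<^sub>v v)" .
    then show "0 \<le> sandwich (W * A * mat_adjoint W) v v"
      using assms(1) mult_mat_vec_carrier[OF W v] by (simp add: psd_mat_iff)
  qed (use A W assms(2) in simp)
qed

lemma psd_mat_diag_entry:
  assumes "psd_mat n A" "i < n"
  shows "0 \<le> A $$ (i, i)"
  using assms sandwich_unit[of A n i i] unfolding psd_mat_iff by (metis unit_vec_carrier)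

lemma psd_mat_trace_nonneg: "psd_mat n A \<Longrightarrow> 0 \<le> Re (mat_trace A)"
  using psd_mat_diag_entry[of n A] psd_mat_carrier[of n A]
  by (auto simp: mat_trace_def less_eq_complex_def intro!: sum_nonneg)

lemma psd_mat_diag:
  assumes "\<And>i. i < n \<Longrightarrow> d i \<ge> 0"
  shows "psd_mat n (mat_diag n (\<lambda>i. complex_of_real (d i)))"
  unfolding psd_mat_iff
proof (intro conjI ballI)
  fix v :: "complex vec" assume v: "v \<in> carrier_vec n"
  have "sandwich (mat_diag n (\<lambda>i. complex_of_real (d i))) v v
     = (\<Sum>i<n. of_real (d i * (cmod (v $ i))\<^sup>2))"
    unfolding sandwich_sum[OF mat_diag_dim v v]
    by (intro sum.cong refl) (simp add: mat_diag_def if_distrib[of "\<lambda>x. x * _"] of_real_cmod_square mult.assoc cong: if_cong)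
  also have "\<dots> = of_real (\<Sum>i<n. d i * (cmod (v $ i))\<^sup>2)" by simp
  finally show "0 \<le> sandwich (mat_diag n (\<lambda>i. complex_of_real (d i))) v v"
    using assms by (auto simp: less_eq_complex_def intro!: sum_nonneg)
qed simp

lemma psd_diagonalization:
  assumes "psd_mat n A"
  shows "\<exists>U d. unitary_mat n U \<and> (\<forall>i<n. d i \<ge> 0) \<and> A = U * mat_diag n (\<lambda>i. of_real (d i)) * mat_adjoint U"
proof -
  obtain U d where U: "unitary_mat n U" and A: "A = U * mat_diag n (\<lambda>i. of_real (d i)) * mat_adjoint U"
    using hermitian_diagonalization[OF psd_mat_hermitian[OF assms]] by blast
  have Uc: "U \<in> carrier_mat n n" "mat_adjoint U \<in> carrier_mat n n" using U by (auto simp: unitary_mat_def)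
  have "mat_adjoint U * A * U = mat_diag n (\<lambda>i. of_real (d i))"
    using unitary_conj_cancel[OF unitary_mat_adjoint[OF U] mat_diag_dim] by (simp add: A)
  then have "psd_mat n (mat_diag n (\<lambda>i. complex_of_real (d i)))"
    using psd_mat_conj[OF assms Uc(2)] by simp
  then have "d i \<ge> 0" if "i < n" for i
    using psd_mat_diag_entry[OF _ that] that by (fastforce simp: mat_diag_def less_eq_complex_def)
  then show ?thesis using U A by blast
qed

section \<open>Square roots of positive semidefinite matrices\<close>

lemma unitary_conj_mult:
  assumes "unitary_mat n U" "A \<in> carrier_mat n n" "B \<in> carrier_mat n n"
  shows "(U * A * mat_adjoint U) * (U * B * mat_adjoint U) = U * (A * B) * mat_adjoint U"
proof -
  have U: "U \<in> carrier_mat n n" using assms by (simp add: unitary_mat_def)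
  have "(U * A * mat_adjoint U) * (U * B * mat_adjoint U) = U * A * (mat_adjoint U * U) * B * mat_adjoint U"
    using assms(2,3) U by (simp add: assoc_mat_dim)
  also have "\<dots> = U * A * B * mat_adjoint U"
    using assms U by (simp add: unitary_mat_def right_mult_one_mat[of _ n n])
  finally show ?thesis using assms(2,3) U by (simp add: assoc_mat_dim)
qed

text \<open>Replaces a conjugation by an intertwining relation, which can be composed with further
  factors.\<close>

lemma unitary_conj_swap:
  assumes "unitary_mat n U" "A \<in> carrier_mat n n" "B \<in> carrier_mat n n"
  shows "A * U = U * B \<longleftrightarrow> A = U * B * mat_adjoint U"
proof -
  have U: "U \<in> carrier_mat n n" and UU: "U * mat_adjoint U = 1\<^sub>m n" "mat_adjoint U * U = 1\<^sub>m n"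
    using assms by (auto simp add: unitary_mat_def)
  have "A * U * mat_adjoint U = A * (U * mat_adjoint U)" using assms(2) U by (simp add: assoc_mat_dim)
  then have 1: "A * U * mat_adjoint U = A" using assms(2) by (simp add: UU right_mult_one_mat[of _ n n])
  have "U * B * mat_adjoint U * U = U * B * (mat_adjoint U * U)" using assms(3) U by (simp add: assoc_mat_dim)
  then have 2: "U * B * mat_adjoint U * U = U * B" using assms(3) U by (simp add: UU right_mult_one_mat[of _ n n])
  show ?thesis using 1 2 by metis
qed

text \<open>Let \<open>W\<close> be the change between the eigenbases of \<open>S\<close> and
  \<open>R\<close>. Equality of the squares says that \<open>W\<close> intertwines the squared
  eigenvalues; wherever an entry of \<open>W\<close> is nonzero, nonnegativity gives equality of the
  eigenvalues themselves, so \<open>W\<close> also intertwines the roots. This makes the definite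
  description in \<open>psd_sqrt\<close> meaningful.\<close>

lemma psd_root_unique:
  assumes "psd_mat n S" "psd_mat n R" "S * S = R * R"
  shows "S = R"
proof -
  obtain U s where U: "unitary_mat n U" and s0: "\<And>i. i < n \<Longrightarrow> s i \<ge> 0"
    and S: "S = U * mat_diag n (\<lambda>i. of_real (s i)) * mat_adjoint U"
    using psd_diagonalization[OF assms(1)] by blast
  obtain V r where V: "unitary_mat n V" and r0: "\<And>i. i < n \<Longrightarrow> r i \<ge> 0"
    and R: "R = V * mat_diag n (\<lambda>i. of_real (r i)) * mat_adjoint V"
    using psd_diagonalization[OF assms(2)] by blast
  let ?s = "\<lambda>i. complex_of_real (s i)" and ?r = "\<lambda>i. complex_of_real (r i)"
  have c: "U \<in> carrier_mat n n" "V \<in> carrier_mat n n" "S \<in> carrier_mat n n" "R \<in> carrier_mat n n"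
    using U V assms by (auto simp: unitary_mat_def psd_mat_def)
  define W where "W = mat_adjoint U * V"
  have W: "W \<in> carrier_mat n n" using c by (simp add: W_def)
  have VW: "U * W = V"
  proof -
    have "U * W = (U * mat_adjoint U) * V" using c by (simp add: W_def assoc_mat_dim)
    then show ?thesis using U c by (simp add: unitary_mat_def)
  qed
  have SU: "S * U = U * mat_diag n ?s"
    using unitary_conj_swap[OF U c(3) mat_diag_dim] S by blast
  have RV: "R * V = V * mat_diag n ?r"
    using unitary_conj_swap[OF V c(4) mat_diag_dim] R by blast
  have cancel: "X = Y" if "U * X = U * Y" "X \<in> carrier_mat n n" "Y \<in> carrier_mat n n" for X Y
  proof -
    have "mat_adjoint U * (U * X) = mat_adjoint U * (U * Y)" using that by simp
    then have "(mat_adjoint U * U) * X = (mat_adjoint U * U) * Y" using that c by (simp add: assoc_mat_dim)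
    then show ?thesis using U that by (simp add: unitary_mat_def)
  qed
  have "U * (mat_diag n ?s * mat_diag n ?s * W) = S * S * U * W"
  proof -
    have "S * S * U * W = S * (S * U) * W" using c W by (simp add: assoc_mat_dim)
    also have "\<dots> = S * (U * mat_diag n ?s) * W" by (simp only: SU)
    also have "\<dots> = S * U * mat_diag n ?s * W" using c W by (simp add: assoc_mat_dim)
    also have "\<dots> = U * mat_diag n ?s * mat_diag n ?s * W" by (simp only: SU)
    also have "\<dots> = U * (mat_diag n ?s * mat_diag n ?s * W)" using c W
      by (simp add: assoc_mat_dim del: mat_diag_diag)
    finally show ?thesis by simp
  qed
  also have "\<dots> = R * R * (U * W)"
    unfolding assms(3)[symmetric] using c W by (simp add: assoc_mat_dim)
  also have "\<dots> = R * R * V" by (simp only: VW)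
  also have "\<dots> = U * (W * (mat_diag n ?r * mat_diag n ?r))"
  proof -
    have "R * R * V = R * (R * V)" using c by (simp add: assoc_mat_dim)
    also have "\<dots> = R * (V * mat_diag n ?r)" by (simp only: RV)
    also have "\<dots> = R * V * mat_diag n ?r" using c by (simp add: assoc_mat_dim)
    also have "\<dots> = V * mat_diag n ?r * mat_diag n ?r" by (simp only: RV)
    also have "\<dots> = V * (mat_diag n ?r * mat_diag n ?r)" using c
      by (simp add: assoc_mat_dim del: mat_diag_diag)
    also have "\<dots> = U * W * (mat_diag n ?r * mat_diag n ?r)" by (simp add: VW)
    finally show ?thesis using c W by (simp add: assoc_mat_dim del: mat_diag_diag)
  qed
  finally have "mat_diag n ?s * mat_diag n ?s * W = W * (mat_diag n ?r * mat_diag n ?r)"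
    using cancel W by simp
  then have sq: "of_real (s i * s i) * W $$ (i, j) = W $$ (i, j) * of_real (r j * r j)" if "i < n" "j < n" for i j
    using arg_cong[of _ _ "\<lambda>M. M $$ (i, j)"] that W
    by (fastforce simp: mat_diag_mult_left[of _ n n] mat_diag_mult_right[of _ n n])
  have "of_real (s i) * W $$ (i, j) = W $$ (i, j) * of_real (r j)" if "i < n" "j < n" for i j
  proof (cases "W $$ (i, j) = 0")
    case False
    then have "complex_of_real (s i * s i) = of_real (r j * r j)" using sq[OF that] by simp
    then have "s i * s i = r j * r j" using of_real_eq_iff by blast
    then have "s i = r j"
      using s0[OF that(1)] r0[OF that(2)] by (metis abs_of_nonneg real_sqrt_mult_self real_sqrt_abs2)
    then show ?thesis by simp
  qed simp
  then have sW: "mat_diag n ?s * W = W * mat_diag n ?r"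
    using W by (auto simp: mat_diag_mult_left[of _ n n] mat_diag_mult_right[of _ n n] intro!: eq_matI)
  have "S * V = S * (U * W)" by (simp only: VW)
  also have "\<dots> = S * U * W" using c W by (simp add: assoc_mat_dim)
  also have "\<dots> = U * mat_diag n ?s * W" by (simp only: SU)
  also have "\<dots> = U * (mat_diag n ?s * W)" using c W by (simp add: assoc_mat_dim)
  also have "\<dots> = U * (W * mat_diag n ?r)" by (simp only: sW)
  also have "\<dots> = U * W * mat_diag n ?r" using c W by (simp add: assoc_mat_dim)
  also have "\<dots> = V * mat_diag n ?r" by (simp add: VW)
  finally show ?thesis
    using unitary_conj_swap[OF V c(3) mat_diag_dim] R by blast
qed

lemma psd_root_exists:
  assumes "psd_mat n A"
  shows "\<exists>S. psd_mat n S \<and> S * S = A"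
proof -
  obtain U d where U: "unitary_mat n U" and d: "\<And>i. i < n \<Longrightarrow> d i \<ge> 0"
    and A: "A = U * mat_diag n (\<lambda>i. of_real (d i)) * mat_adjoint U"
    using psd_diagonalization[OF assms] by blast
  let ?D = "mat_diag n (\<lambda>i. complex_of_real (sqrt (d i)))"
  have "psd_mat n (U * ?D * mat_adjoint U)"
    using U d by (intro psd_mat_conj psd_mat_diag) (auto simp: unitary_mat_def)
  moreover have "?D * ?D = mat_diag n (\<lambda>i. of_real (d i))"
    unfolding mat_diag_diag using d by (auto simp: mat_diag_def simp flip: of_real_mult)
  then have "(U * ?D * mat_adjoint U) * (U * ?D * mat_adjoint U) = A"
    unfolding A by (subst unitary_conj_mult[OF U]) auto
  ultimately show ?thesis by blast
qed

lemma psd_sqrt_eqI: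
  assumes "psd_mat n S" "S * S = A"
  shows "psd_sqrt A = S"
  unfolding psd_sqrt_def
proof (rule the_equality)
  have "dim_row A = n" using assms psd_mat_carrier by fastforce
  then show "psd_mat (dim_row A) S \<and> S * S = A"
    and "\<And>R. psd_mat (dim_row A) R \<and> R * R = A \<Longrightarrow> R = S"
    using assms psd_root_unique[of n] by auto
qed

lemma psd_sqrt_psd:
  assumes "psd_mat n A"
  shows "psd_mat n (psd_sqrt A)" "psd_sqrt A * psd_sqrt A = A"
proof -
  obtain S where S: "psd_mat n S" "S * S = A" using psd_root_exists[OF assms] by blast
  then have "psd_sqrt A = S" by (rule psd_sqrt_eqI)
  with S show "psd_mat n (psd_sqrt A)" "psd_sqrt A * psd_sqrt A = A" by auto
qed

section \<open>Rank-one states and their fidelity\<close>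

lemma pure_state_carrier: "v \<in> carrier_vec n \<Longrightarrow> pure_state v \<in> carrier_mat n n"
  by (simp add: pure_state_def)

lemma sandwich_pure_state:
  assumes "v \<in> carrier_vec n" "u \<in> carrier_vec n" "w \<in> carrier_vec n"
  shows "sandwich (pure_state v) u w = (v \<bullet>c u) * (w \<bullet>c v)"
  using assms
  by (simp add: sandwich_sum[OF pure_state_carrier] cscalar_prod_sum[of _ n] sum_product)
     (auto simp: pure_state_def intro!: sum.cong)

lemma cscalar_prod_swap:
  assumes "v \<in> carrier_vec n" "w \<in> carrier_vec n"
  shows "v \<bullet>c w = cnj (w \<bullet>c (v :: complex vec))"
  using assms by (simp add: cscalar_prod_sum[of _ n] mult.commute)

lemma psd_pure_state:
  assumes "v \<in> carrier_vec n"
  shows "psd_mat n (pure_state v)"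
  unfolding psd_mat_iff
proof (intro conjI ballI)
  fix w :: "complex vec" assume w: "w \<in> carrier_vec n"
  have "sandwich (pure_state v) w w = of_real ((cmod (w \<bullet>c v))\<^sup>2)"
    using assms w by (simp add: sandwich_pure_state cscalar_prod_swap[OF assms w] of_real_cmod_square mult.commute)
  then show "0 \<le> sandwich (pure_state v) w w" by (simp add: less_eq_complex_def)
qed (use assms in \<open>simp add: pure_state_carrier\<close>)

lemma mat_trace_pure_state: "mat_trace (pure_state v) = v \<bullet>c v"
  by (auto simp: mat_trace_def pure_state_def scalar_prod_def atLeast0LessThan)

lemma pure_state_square:
  assumes "v \<in> carrier_vec n"
  shows "pure_state v * pure_state v = (v \<bullet>c v) \<cdot>\<^sub>m pure_state v"
  using assms
  by (intro eq_matI)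
     (auto simp: pure_state_def scalar_prod_def sum_distrib_left sum_distrib_right intro!: sum.cong)

lemma conj_pure_state:
  assumes "v \<in> carrier_vec n" "A \<in> carrier_mat n n"
  shows "A * pure_state v * mat_adjoint A = pure_state (A *\<^sub>v v)"
proof (rule eq_matI)
  fix i j assume "i < dim_row (pure_state (A *\<^sub>v v))" "j < dim_col (pure_state (A *\<^sub>v v))"
  then have ij: "i < n" "j < n" using assms by (auto simp: pure_state_def)
  have P: "pure_state v \<in> carrier_mat n n" using assms by (simp add: pure_state_carrier)
  have 1: "(A * pure_state v) $$ (i, l) = (A *\<^sub>v v) $ i * cnj (v $ l)" if "l < n" for l
    using assms ij that P
    by (subst mat_mult_index[of _ n n])
       (auto simp: pure_state_def scalar_prod_def atLeast0LessThan sum_distrib_right intro!: sum.cong)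
  have "(A * pure_state v * mat_adjoint A) $$ (i, j) = (\<Sum>l<n. (A *\<^sub>v v) $ i * (cnj (v $ l) * cnj (A $$ (j, l))))"
    using assms ij P 1 by (subst mat_mult_index[of _ n n]) (auto intro!: sum.cong)
  also have "\<dots> = (A *\<^sub>v v) $ i * cnj ((A *\<^sub>v v) $ j)"
    using assms ij by (auto simp: scalar_prod_def atLeast0LessThan sum_distrib_left mult_ac intro!: sum.cong)
  finally show "(A * pure_state v * mat_adjoint A) $$ (i, j) = pure_state (A *\<^sub>v v) $$ (i, j)"
    using assms ij by (simp add: pure_state_def)
qed (use assms in \<open>auto simp: pure_state_def\<close>)

lemma psd_mat_smult:
  assumes "psd_mat n A" "c \<ge> 0"
  shows "psd_mat n (complex_of_real c \<cdot>\<^sub>m A)"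
  using assms by (auto simp: psd_mat_iff sandwich_smult_mat[of _ n] less_eq_complex_def)

lemma mat_trace_smult: "A \<in> carrier_mat n n \<Longrightarrow> mat_trace (c \<cdot>\<^sub>m A) = c * mat_trace A"
  by (simp add: mat_trace_def sum_distrib_left)

text \<open>With \<open>w\<close> the image of \<open>v\<close> under the root of
  \<open>\<rho>\<close>, the operator under the outer root is the rank-one
  \<open>pure_state w\<close>. Its root is \<open>pure_state w\<close> divided by the norm of
  \<open>w\<close>, and the trace of that is the norm of \<open>w\<close>.\<close>

lemma fidelity_pure_state:
  assumes "psd_mat n \<rho>" "v \<in> carrier_vec n"
  shows "fidelity \<rho> (pure_state v) = sqrt (Re (sandwich \<rho> v v))"
proof -
  define S where "S = psd_sqrt \<rho>"
  have S: "psd_mat n S" "S * S = \<rho>" using psd_sqrt_psd[OF assms(1)] by (auto simp: S_def)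
  have Sc: "S \<in> carrier_mat n n" and Sh: "mat_adjoint S = S"
    using psd_mat_hermitian[OF S(1)] by (auto simp: hermitian_mat_def)
  define w where "w = S *\<^sub>v v"
  have w: "w \<in> carrier_vec n" using Sc assms(2) by (simp add: w_def)
  have SvS: "S * pure_state v * S = pure_state w"
    using conj_pure_state[OF assms(2) Sc] by (simp add: Sh w_def)
  define r where "r = sqrt (Re (w \<bullet>c w))"
  have "0 \<le> w \<bullet>c w" by (rule conjugate_square_ge_0_vec)
  then have re: "w \<bullet>c w = of_real (Re (w \<bullet>c w))" and ge: "Re (w \<bullet>c w) \<ge> 0"
    by (auto simp: less_eq_complex_def complex_eq_iff)
  have rr: "w \<bullet>c w = of_real (r * r)" using re ge by (simp add: r_def)
  have r: "r \<ge> 0" using ge by (simp add: r_def)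
  let ?Q = "complex_of_real (1 / r) \<cdot>\<^sub>m pure_state w"
  have P: "pure_state w \<in> carrier_mat n n" using w by (rule pure_state_carrier)
  have "?Q * ?Q = of_real (1 / r * (1 / r) * (r * r)) \<cdot>\<^sub>m pure_state w"
    using P pure_state_square[OF w]
    by (intro eq_matI) (auto simp: rr mult_smult_distrib[OF P P]
      mult_smult_assoc_mat[OF P smult_carrier_mat[OF P]])
  also have "\<dots> = pure_state w"
  \<comment> \<open>For \<open>r = 0\<close> the quotient \<open>1 / r\<close> is 0, and
    \<open>w\<close> vanishes, so the formula for the root remains correct.\<close>
  proof (cases "r = 0")
    case True
    then have "w = 0\<^sub>v n" using rr conjugate_square_eq_0_vec[OF w] by simp
    then show ?thesis using True by (intro eq_matI) (auto simp: pure_state_def)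
  qed (auto intro!: eq_matI)
  finally have "psd_sqrt (pure_state w) = ?Q"
    using r by (intro psd_sqrt_eqI[of n] psd_mat_smult psd_pure_state w) auto
  then have "fidelity \<rho> (pure_state v) = Re (mat_trace ?Q)"
    unfolding fidelity_def S_def[symmetric] SvS by simp
  also have "\<dots> = r" using rr by (simp add: mat_trace_smult[OF P] mat_trace_pure_state)
  finally have "fidelity \<rho> (pure_state v) = r" .
  moreover have "w \<bullet>c w = sandwich \<rho> v v"
    using sandwich_mult_left[OF Sc Sc assms(2) assms(2)]
    by (simp add: S(2) Sh sandwich_def w_def)
  ultimately show ?thesis by (simp add: r_def)
qed

text \<open>Supplies the lower bound that the infimum in \<open>channel_fidelity\<close>
  requires.\<close>

lemma fidelity_nonneg:
  assumes "psd_mat n \<rho>" "psd_mat n \<sigma>"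
  shows "0 \<le> fidelity \<rho> \<sigma>"
proof -
  have S: "psd_mat n (psd_sqrt \<rho>)" using psd_sqrt_psd[OF assms(1)] by simp
  then have "mat_adjoint (psd_sqrt \<rho>) = psd_sqrt \<rho>"
    using psd_mat_hermitian by (simp add: hermitian_mat_def)
  then have "psd_mat n (psd_sqrt \<rho> * \<sigma> * psd_sqrt \<rho>)"
    using psd_mat_conj[OF assms(2) psd_mat_carrier[OF S]] by simp
  then show ?thesis unfolding fidelity_def by (intro psd_mat_trace_nonneg psd_sqrt_psd(1))
qed

section \<open>Quantum Fisher information\<close>

lemma mat_trace_add:
  assumes "A \<in> carrier_mat n n" "B \<in> carrier_mat n n"
  shows "mat_trace (A + B) = mat_trace A + mat_trace B"
  using assms by (simp add: mat_trace_def sum.distrib)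

lemma mat_trace_comm:
  assumes "A \<in> carrier_mat n n" "B \<in> carrier_mat n n"
  shows "mat_trace (A * B) = mat_trace (B * A)"
proof -
  have "mat_trace (A * B) = (\<Sum>i<n. \<Sum>k<n. A $$ (i, k) * B $$ (k, i))"
    using assms by (simp add: mat_trace_def scalar_prod_def atLeast0LessThan)
  also have "\<dots> = (\<Sum>k<n. \<Sum>i<n. A $$ (i, k) * B $$ (k, i))" by (rule sum.swap)
  also have "\<dots> = mat_trace (B * A)"
    using assms by (simp add: mat_trace_def scalar_prod_def atLeast0LessThan mult.commute)
  finally show ?thesis .
qed

lemma hermitian_mat_add:
  assumes A: "hermitian_mat n A" and B: "hermitian_mat n B"
  shows "hermitian_mat n (A + B)"
proof (rule hermitian_matI)
  show "A + B \<in> carrier_mat n n" using assms by (simp add: hermitian_mat_def)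
  have "B \<in> carrier_mat n n" using B by (simp add: hermitian_mat_def)
  moreover fix i j assume "i < n" "j < n"
  ultimately show "(A + B) $$ (i, j) = cnj ((A + B) $$ (j, i))"
    using hermitian_mat_index[OF A, of i j] hermitian_mat_index[OF B, of i j] by simp
qed

lemma hermitian_mat_smult_real:
  assumes "hermitian_mat n A"
  shows "hermitian_mat n (complex_of_real c \<cdot>\<^sub>m A)"
proof (rule hermitian_matI)
  have A: "A \<in> carrier_mat n n" using assms by (simp add: hermitian_mat_def)
  then show "complex_of_real c \<cdot>\<^sub>m A \<in> carrier_mat n n" by simp
  fix i j assume "i < n" "j < n"
  then show "(complex_of_real c \<cdot>\<^sub>m A) $$ (i, j) = cnj ((complex_of_real c \<cdot>\<^sub>m A) $$ (j, i))"
    using A hermitian_mat_index[OF assms, of i j] by simp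
qed

text \<open>The right-hand side is the trace of \<open>M * \<sigma> * M\<close> for the Hermitian
  \<open>M = L + r K\<close>, expanded in \<open>r\<close> with the help of cyclicity. Both
  applications take \<open>r = -1\<close>.\<close>

lemma trace_square_expansion:
  assumes "psd_mat n \<sigma>" "hermitian_mat n L" "hermitian_mat n K"
  shows "0 \<le> Re (mat_trace (\<sigma> * (L * L)))
     + r * Re (mat_trace ((\<sigma> * L + L * \<sigma>) * K)) + r\<^sup>2 * Re (mat_trace (\<sigma> * (K * K)))"
proof -
  let ?r = "complex_of_real r"
  have c: "\<sigma> \<in> carrier_mat n n" "L \<in> carrier_mat n n" "K \<in> carrier_mat n n"
    using assms by (auto simp: psd_mat_def hermitian_mat_def)
  define M where "M = L + ?r \<cdot>\<^sub>m K"
  have M: "hermitian_mat n M" unfolding M_def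
    using assms by (intro hermitian_mat_add hermitian_mat_smult_real)
  then have Mc: "M \<in> carrier_mat n n" "mat_adjoint M = M" by (auto simp: hermitian_mat_def)
  have "0 \<le> Re (mat_trace (M * \<sigma> * M))"
    using psd_mat_trace_nonneg[OF psd_mat_conj[OF assms(1) Mc(1)]] Mc(2) by simp
  also have "mat_trace (M * \<sigma> * M) = mat_trace (\<sigma> * M * M)"
    using mat_trace_comm[of M n "\<sigma> * M"] c Mc by (simp add: assoc_mat_dim)
  also have "\<sigma> * M * M = (\<sigma> * (L * L) + ?r \<cdot>\<^sub>m (\<sigma> * L * K)) + (?r \<cdot>\<^sub>m (\<sigma> * K * L) + (?r * ?r) \<cdot>\<^sub>m (\<sigma> * (K * K)))"
  proof -
    have kc: "?r \<cdot>\<^sub>m K \<in> carrier_mat n n" using c by simp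
    have "\<sigma> * M * M = \<sigma> * (M * M)" using c Mc by (simp add: assoc_mat_dim)
    also have "M * M = (L * L + ?r \<cdot>\<^sub>m (L * K)) + (?r \<cdot>\<^sub>m (K * L) + (?r * ?r) \<cdot>\<^sub>m (K * K))"
      unfolding M_def using c kc
      by (simp add: add_mult_distrib_mat[of _ n n] mult_add_distrib_mat[of _ n n] mult_smult_distrib[of _ n n]
          mult_smult_assoc_mat[of _ n n]) (auto intro!: eq_matI simp: algebra_simps)
    also have "\<sigma> * \<dots> = (\<sigma> * (L * L) + ?r \<cdot>\<^sub>m (\<sigma> * L * K)) + (?r \<cdot>\<^sub>m (\<sigma> * K * L) + (?r * ?r) \<cdot>\<^sub>m (\<sigma> * (K * K)))"
      using c
      by (simp add: mult_add_distrib_mat[of _ n n _ n] mult_smult_distrib[of _ n n _ n] assoc_mat_dim)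
    finally show ?thesis .
  qed
  also have "mat_trace \<dots> = mat_trace (\<sigma> * (L * L)) + ?r * mat_trace ((\<sigma> * L + L * \<sigma>) * K) + ?r * ?r * mat_trace (\<sigma> * (K * K))"
  proof -
    have "mat_trace (\<sigma> * K * L) = mat_trace (L * \<sigma> * K)"
      using mat_trace_comm[of "\<sigma> * K" n L] c by (simp add: assoc_mat_dim)
    moreover have "(\<sigma> * L + L * \<sigma>) * K = \<sigma> * L * K + L * \<sigma> * K"
      using c by (intro add_mult_distrib_mat[of _ n n]) auto
    ultimately show ?thesis
      using c by (simp add: mat_trace_add[of _ n] mat_trace_smult[of _ n] algebra_simps del: assoc_mult_mat)
  qed
  finally show ?thesis by (simp add: power2_eq_square)
qed

text \<open>The expansion with the identity for \<open>L\<close>, the projection for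
  \<open>K\<close> and \<open>r = -1\<close>: the complementary projection has nonnegative
  weight.\<close>

lemma trace_projection_le:
  assumes "psd_mat n \<sigma>" "hermitian_mat n P" "P * P = P"
  shows "Re (mat_trace (\<sigma> * P)) \<le> Re (mat_trace \<sigma>)"
proof -
  have c: "\<sigma> \<in> carrier_mat n n" "P \<in> carrier_mat n n"
    using assms by (auto simp: psd_mat_def hermitian_mat_def)
  have "hermitian_mat n (1\<^sub>m n)" by (rule hermitian_matI) auto
  from trace_square_expansion[OF assms(1) this assms(2), of "-1"]
  have "0 \<le> Re (mat_trace \<sigma>) - Re (mat_trace ((\<sigma> + \<sigma>) * P)) + Re (mat_trace (\<sigma> * P))"
    using c by (simp add: assms(3) right_mult_one_mat[of _ n n] left_mult_one_mat[of _ n n])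
  moreover have "(\<sigma> + \<sigma>) * P = \<sigma> * P + \<sigma> * P"
    using c by (intro add_mult_distrib_mat[of _ n n]) auto
  ultimately show ?thesis using c by (simp add: mat_trace_add[of _ n])
qed

text \<open>In an eigenbasis of \<open>\<sigma>\<close> the equation decouples into
  \<open>(p i + p j) * M $$ (i, j) = 2 * E $$ (i, j)\<close>. The only obstruction sits where both
  eigenvalues vanish, and there polarization of the condition on the kernel gives
  \<open>E $$ (i, j) = 0\<close>.\<close>

lemma symmetric_logarithmic_derivative_exists:
  assumes \<sigma>: "psd_mat n \<sigma>" and D: "hermitian_mat n D"
    and ker: "\<And>v. v \<in> carrier_vec n \<Longrightarrow> \<sigma> *\<^sub>v v = 0\<^sub>v n \<Longrightarrow> sandwich D v v = 0"
  shows "\<exists>L. hermitian_mat n L \<and> D = (1 / 2) \<cdot>\<^sub>m (\<sigma> * L + L * \<sigma>)"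
proof -
  obtain U p where U: "unitary_mat n U" and p: "\<And>i. i < n \<Longrightarrow> p i \<ge> 0"
    and \<sigma>U: "\<sigma> = U * mat_diag n (\<lambda>i. of_real (p i)) * mat_adjoint U"
    using psd_diagonalization[OF \<sigma>] by blast
  define P where "P = mat_diag n (\<lambda>i. complex_of_real (p i))"
  define E where "E = mat_adjoint U * D * U"
  have c: "U \<in> carrier_mat n n" "mat_adjoint U \<in> carrier_mat n n" "D \<in> carrier_mat n n"
    "\<sigma> \<in> carrier_mat n n" "P \<in> carrier_mat n n"
    using U D \<sigma> by (auto simp: unitary_mat_def hermitian_mat_def psd_mat_def P_def)
  have E: "hermitian_mat n E"
    using hermitian_conj[OF D c(2)] by (simp add: E_def)
  then have Ec: "E \<in> carrier_mat n n" by (simp add: hermitian_mat_def)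
  have DE: "D = U * E * mat_adjoint U"
    using unitary_conj_cancel[OF U c(3)] by (simp add: E_def)
  have \<sigma>U': "\<sigma> * U = U * P"
    using unitary_conj_swap[OF U c(4,5)] \<sigma>U by (simp add: P_def)
  \<comment> \<open>\<open>U\<close> maps the kernel of \<open>P\<close> into the kernel of
    \<open>\<sigma>\<close>, which carries the hypothesis over to the eigenbasis.\<close>
  have kerE: "sandwich E v v = 0" if v: "v \<in> carrier_vec n" and Pv: "P *\<^sub>v v = 0\<^sub>v n" for v
  proof -
    have Uv: "U *\<^sub>v v \<in> carrier_vec n" using c v by simp
    have "\<sigma> *\<^sub>v (U *\<^sub>v v) = (\<sigma> * U) *\<^sub>v v" using c v by (simp add: assoc_mult_mat_vec[of _ n n _ n])
    also have "\<dots> = U *\<^sub>v (P *\<^sub>v v)" unfolding \<sigma>U' using c v by (simp add: assoc_mult_mat_vec[of _ n n _ n])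
    also have "\<dots> = 0\<^sub>v n" unfolding Pv using c by (intro eq_vecI) (auto simp: scalar_prod_def)
    finally have "sandwich D (U *\<^sub>v v) (U *\<^sub>v v) = 0" using ker[OF Uv] by blast
    moreover have "sandwich E v v = sandwich (D * U) (U *\<^sub>v v) v"
      using sandwich_mult_left[OF c(2) _ v v, of "D * U"] c by (simp add: E_def assoc_mat_dim)
    moreover have "\<dots> = sandwich D (U *\<^sub>v v) (U *\<^sub>v v)"
      using sandwich_mult_right[OF c(3,1) Uv v] .
    ultimately show ?thesis by simp
  qed
  have comb: "E $$ (i, i) + c * E $$ (i, j) + cnj c * E $$ (j, i) + c * cnj c * E $$ (j, j) = 0"
    if ij: "i < n" "j < n" and p0: "p i = 0" "p j = 0" for i j c
    unfolding sandwich_unit_combination[OF Ec ij, symmetric]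
  proof (rule kerE)
    show "P *\<^sub>v (unit_vec n i + c \<cdot>\<^sub>v unit_vec n j) = 0\<^sub>v n"
      using p0 ij by (intro eq_vecI)
        (auto simp: P_def mat_diag_def scalar_prod_def unit_vec_def intro!: sum.neutral)
  qed simp
  have E0: "E $$ (i, j) = 0" if "i < n" "j < n" "p i = 0" "p j = 0" for i j
  proof -
    have "E $$ (i, i) = 0" "E $$ (j, j) = 0"
      using comb[of i i 0] comb[of j j 0] that by simp_all
    then have "c * E $$ (i, j) + cnj c * E $$ (j, i) = 0" for c
      using comb[OF that, of c] by simp
    from this[of 1] this[of \<i>] show ?thesis by (simp add: add_eq_0_iff)
  qed
  \<comment> \<open>Division by zero puts 0 on the kernel block, one admissible choice there since
    \<open>E\<close> vanishes on it by \<open>E0\<close>.\<close>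
  define M where "M = mat n n (\<lambda>(i, j). 2 * E $$ (i, j) / of_real (p i + p j))"
  have Mc: "M \<in> carrier_mat n n" by (simp add: M_def)
  have M: "hermitian_mat n M"
  proof (rule hermitian_matI[OF Mc])
    fix i j assume "i < n" "j < n"
    then show "M $$ (i, j) = cnj (M $$ (j, i))"
      using hermitian_mat_index[OF E, of i j] by (simp add: M_def add.commute)
  qed
  have PM: "P * M + M * P = 2 \<cdot>\<^sub>m E"
  proof (rule eq_matI)
    fix i j assume "i < dim_row (2 \<cdot>\<^sub>m E)" "j < dim_col (2 \<cdot>\<^sub>m E)"
    then have ij: "i < n" "j < n" using Ec by auto
    have "(P * M + M * P) $$ (i, j) = of_real (p i + p j) * M $$ (i, j)"
      using ij Mc by (simp add: P_def mat_diag_mult_left[of _ n n] mat_diag_mult_right[of _ n n] algebra_simps)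
    also have "\<dots> = 2 * E $$ (i, j)"
    proof (cases "p i + p j = 0")
      case True
      then have "p i = 0" "p j = 0" using p[OF ij(1)] p[OF ij(2)] by auto
      then show ?thesis using E0[OF ij] True by simp
    next
      case False
      then have "complex_of_real (p i + p j) \<noteq> 0" by (metis of_real_eq_0_iff)
      then show ?thesis using ij by (simp add: M_def)
    qed
    finally show "(P * M + M * P) $$ (i, j) = (2 \<cdot>\<^sub>m E) $$ (i, j)" using ij Ec by simp
  qed (use c Mc Ec in auto)
  define L where "L = U * M * mat_adjoint U"
  have L: "hermitian_mat n L" unfolding L_def by (rule hermitian_conj[OF M c(1)])
  have "\<sigma> * L + L * \<sigma> = U * (P * M) * mat_adjoint U + U * (M * P) * mat_adjoint U"
    using unitary_conj_mult[OF U c(5) Mc] unitary_conj_mult[OF U Mc c(5)] \<sigma>U by (simp add: L_def P_def)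
  also have "\<dots> = U * (P * M + M * P) * mat_adjoint U"
    using c Mc by (simp add: mult_add_distrib_mat[of _ n n _ n] add_mult_distrib_mat[of _ n n _ _ n])
  also have "\<dots> = 2 \<cdot>\<^sub>m D"
    unfolding PM DE using c Ec
    by (simp add: mult_smult_distrib[of _ n n _ n] mult_smult_assoc_mat[of _ n n _ n])
  finally have "(1 / 2) \<cdot>\<^sub>m (\<sigma> * L + L * \<sigma>) = D" using c by (auto intro!: eq_matI)
  then show ?thesis using L by metis
qed

section \<open>Derivatives of families of states and the variational bound\<close>

lemma has_mat_derivative_sandwich:
  assumes "has_mat_derivative n f D (at \<theta> within S)" "\<theta> \<in> S"
    and "\<And>t. t \<in> S \<Longrightarrow> f t \<in> carrier_mat n n" "v \<in> carrier_vec n" "w \<in> carrier_vec n"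
  shows "((\<lambda>t. sandwich (f t) v w) has_vector_derivative sandwich D v w) (at \<theta> within S)"
proof -
  have D: "D \<in> carrier_mat n n" using assms(1) by (simp add: has_mat_derivative_def)
  have "((\<lambda>t. \<Sum>i<n. \<Sum>j<n. f t $$ (i, j) * w $ j * cnj (v $ i)) has_vector_derivative sandwich D v w) (at \<theta> within S)"
    unfolding sandwich_sum[OF D assms(4,5)] using assms(1)
    by (auto simp: has_mat_derivative_def intro!: has_vector_derivative_sum has_vector_derivative_mult_left)
  then show ?thesis
    using assms unfolding has_vector_derivative_def
    by (elim has_derivative_transform[rotated 2]) (auto simp: sandwich_sum[of _ n])
qed

text \<open>Opposite entries are conjugate along the family, so their derivatives are conjugate by
  uniqueness of the derivative, taken as a two-sided one at an interior point.\<close>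

lemma has_mat_derivative_hermitian:
  assumes "has_mat_derivative n f D (at \<theta> within {a..b})" "a < \<theta>" "\<theta> < b"
    and "\<And>t. t \<in> {a..b} \<Longrightarrow> hermitian_mat n (f t)"
  shows "hermitian_mat n D"
proof (rule hermitian_matI)
  show "D \<in> carrier_mat n n" using assms(1) by (simp add: has_mat_derivative_def)
  fix i j assume ij: "i < n" "j < n"
  have at: "at \<theta> within {a..b} = at \<theta>" using assms(2,3) by (rule at_within_Icc_at)
  have 1: "((\<lambda>t. f t $$ (i, j)) has_vector_derivative D $$ (i, j)) (at \<theta>)"
    and "((\<lambda>t. f t $$ (j, i)) has_vector_derivative D $$ (j, i)) (at \<theta>)"
    using assms(1) ij unfolding at has_mat_derivative_def by auto
  then have "((\<lambda>t. cnj (f t $$ (j, i))) has_vector_derivative cnj (D $$ (j, i))) (at \<theta>)"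
    by (intro has_vector_derivative_cnj)
  then have "((\<lambda>t. f t $$ (i, j)) has_vector_derivative cnj (D $$ (j, i))) (at \<theta>)"
    unfolding has_vector_derivative_def
  proof (rule has_derivative_transform_within_open[of _ _ _ _ "{a<..<b}"])
    fix t assume "t \<in> {a<..<b}"
    then show "cnj (f t $$ (j, i)) = f t $$ (i, j)"
      using hermitian_mat_index[OF assms(4), of t i j] ij by auto
  qed (use assms in auto)
  from has_derivative_unique[OF 1[unfolded has_vector_derivative_def] this[unfolded has_vector_derivative_def]]
  show "D $$ (i, j) = cnj (D $$ (j, i))" by (metis scaleR_one)
qed

text \<open>A null vector of a state minimizes the quadratic form along the family, so the derivative of
  that form vanishes there. This is what makes the symmetric logarithmic derivative exist at
  interior points.\<close>

lemma qfi_variational_bound: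
  assumes psd: "\<And>t. t \<in> {a..b} \<Longrightarrow> psd_mat n (f t)" and \<theta>: "a < \<theta>" "\<theta> < b"
    and der: "has_mat_derivative n f D (at \<theta> within {a..b})"
  shows "\<exists>q. has_qfi n f {a..b} \<theta> q \<and>
    (\<forall>K. hermitian_mat n K \<longrightarrow> 2 * Re (mat_trace (D * K)) - Re (mat_trace (f \<theta> * (K * K))) \<le> q)"
proof -
  have at: "at \<theta> within {a..b} = at \<theta>" using \<theta> by (rule at_within_Icc_at)
  have D: "hermitian_mat n D"
    by (rule has_mat_derivative_hermitian[OF der \<theta> psd_mat_hermitian[OF psd]])
  then have Dc: "D \<in> carrier_mat n n" by (simp add: hermitian_mat_def)
  have \<theta>S: "\<theta> \<in> {a..b}" using \<theta> by simp
  have "sandwich D v v = 0" if v: "v \<in> carrier_vec n" and fv: "f \<theta> *\<^sub>v v = 0\<^sub>v n" for v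
  proof -
    have dv: "((\<lambda>t. sandwich (f t) v v) has_vector_derivative sandwich D v v) (at \<theta>)"
      using has_mat_derivative_sandwich[OF der \<theta>S psd_mat_carrier[OF psd] v v] unfolding at by blast
    then have dr: "((\<lambda>t. Re (sandwich (f t) v v)) has_real_derivative Re (sandwich D v v)) (at \<theta>)"
      by (auto simp: has_vector_derivative_complex_iff)
    have di: "((\<lambda>t. Im (sandwich (f t) v v)) has_real_derivative Im (sandwich D v v)) (at \<theta>)"
      using dv by (auto simp: has_vector_derivative_complex_iff)
    have pos: "0 \<le> sandwich (f t) v v" if "\<bar>\<theta> - t\<bar> < min (\<theta> - a) (b - \<theta>)" for t
    proof -
      have "t \<in> {a..b}" using that by auto
      then show ?thesis using psd v by (auto simp: psd_mat_iff)
    qed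
    have zero: "sandwich (f \<theta>) v v = 0" using v by (simp add: sandwich_def fv)
    have d: "0 < min (\<theta> - a) (b - \<theta>)" using \<theta> by simp
    have "Re (sandwich D v v) = 0"
      by (rule DERIV_local_min[OF dr d]) (use pos zero in \<open>auto simp: less_eq_complex_def\<close>)
    \<comment> \<open>The imaginary part is identically 0 near \<open>\<theta>\<close>, so every
      point counts as a local minimum of it.\<close>
    moreover have "Im (sandwich D v v) = 0"
      by (rule DERIV_local_min[OF di d]) (use pos zero in \<open>auto simp: less_eq_complex_def\<close>)
    ultimately show ?thesis by (simp add: complex_eq_iff)
  qed
  then obtain L where L: "hermitian_mat n L" and DL: "D = (1 / 2) \<cdot>\<^sub>m (f \<theta> * L + L * f \<theta>)"
    using symmetric_logarithmic_derivative_exists[OF psd[OF \<theta>S] D] by blast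
  have Lc: "L \<in> carrier_mat n n" using L by (simp add: hermitian_mat_def)
  have fc: "f \<theta> \<in> carrier_mat n n" using psd[OF \<theta>S] by (rule psd_mat_carrier)
  define q where "q = Re (mat_trace (f \<theta> * (L * L)))"
  have "has_qfi n f {a..b} \<theta> q"
    using der Lc DL unfolding has_qfi_def q_def by blast
  \<comment> \<open>This is nonnegativity of the trace of \<open>f \<theta>\<close> against the
    square of \<open>L - K\<close>; the defining equation of \<open>L\<close> turns the cross term
    into \<open>D\<close>.\<close>
  moreover have "2 * Re (mat_trace (D * K)) - Re (mat_trace (f \<theta> * (K * K))) \<le> q" if K: "hermitian_mat n K" for K
  proof -
    have Kc: "K \<in> carrier_mat n n" using K by (simp add: hermitian_mat_def)
    have "f \<theta> * L + L * f \<theta> = 2 \<cdot>\<^sub>m D" using DL fc Lc by (auto intro!: eq_matI)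
    then have "mat_trace ((f \<theta> * L + L * f \<theta>) * K) = 2 * mat_trace (D * K)"
      using Dc Kc by (simp add: mult_smult_assoc_mat[of _ n n _ n] mat_trace_smult[of _ n])
    then show ?thesis
      using trace_square_expansion[OF psd[OF \<theta>S] L K, of "-1"] by (simp add: q_def)
  qed
  ultimately show ?thesis by blast
qed

section \<open>Phase channels and channel fidelity\<close>

lemma conj_mat_diag_index:
  assumes "U \<in> carrier_mat n n" "i < n" "j < n"
  shows "(U * mat_diag n f * mat_adjoint U) $$ (i, j) = (\<Sum>l<n. U $$ (i, l) * f l * cnj (U $$ (j, l)))"
  using assms
  by (simp add: mat_diag_mult_right[of _ n n] mat_mult_index[of _ n n _ n] del: index_mult_mat)

lemma mat_adjoint_conj_mat_diag:
  assumes "U \<in> carrier_mat n n"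
  shows "mat_adjoint (U * mat_diag n f * mat_adjoint U) = U * mat_diag n (\<lambda>i. cnj (f i)) * mat_adjoint U"
proof (rule eq_matI)
  fix i j assume "i < dim_row (U * mat_diag n (\<lambda>i. cnj (f i)) * mat_adjoint U)"
    "j < dim_col (U * mat_diag n (\<lambda>i. cnj (f i)) * mat_adjoint U)"
  then have ij: "i < n" "j < n" using assms by auto
  then have "mat_adjoint (U * mat_diag n f * mat_adjoint U) $$ (i, j) = cnj ((U * mat_diag n f * mat_adjoint U) $$ (j, i))"
    using assms by (intro mat_adjoint_index) auto
  then show "mat_adjoint (U * mat_diag n f * mat_adjoint U) $$ (i, j) = (U * mat_diag n (\<lambda>i. cnj (f i)) * mat_adjoint U) $$ (i, j)"
    using assms ij by (simp add: conj_mat_diag_index mult_ac del: index_mult_mat)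
qed (use assms in auto)

text \<open>Powers commute with unitary conjugation, so each entry of the matrix series is a finite
  combination of scalar exponential series.\<close>

lemma mat_exp_conj_mat_diag:
  assumes U: "unitary_mat n U"
  shows "mat_exp (c \<cdot>\<^sub>m (U * mat_diag n f * mat_adjoint U)) = U * mat_diag n (\<lambda>i. exp (c * f i)) * mat_adjoint U"
proof -
  let ?A = "c \<cdot>\<^sub>m (U * mat_diag n f * mat_adjoint U)"
  have Uc: "U \<in> carrier_mat n n" using U by (simp add: unitary_mat_def)
  have A: "?A = U * mat_diag n (\<lambda>i. c * f i) * mat_adjoint U"
    using Uc by (intro eq_matI)
      (auto simp: conj_mat_diag_index sum_distrib_left mult_ac simp del: index_mult_mat(1) intro!: sum.cong)
  have Ac: "?A \<in> carrier_mat n n" using Uc by simp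
  have pow: "?A ^\<^sub>m k = U * mat_diag n (\<lambda>i. (c * f i) ^ k) * mat_adjoint U" for k
  proof (induction k)
    case 0
    then show ?case using U Uc Ac by (simp add: unitary_mat_def right_mult_one_mat[of _ n n])
  next
    case (Suc k)
    then show ?case using unitary_conj_mult[OF U mat_diag_dim mat_diag_dim, of "\<lambda>i. (c * f i) ^ k" "\<lambda>i. c * f i"]
      by (simp add: A mult.commute)
  qed
  show ?thesis
  proof (rule eq_matI)
    fix i j assume "i < dim_row (U * mat_diag n (\<lambda>i. exp (c * f i)) * mat_adjoint U)"
      "j < dim_col (U * mat_diag n (\<lambda>i. exp (c * f i)) * mat_adjoint U)"
    then have ij: "i < n" "j < n" using Uc by auto
    have "(\<lambda>k. (\<Sum>l<n. U $$ (i, l) * ((c * f l) ^ k /\<^sub>R fact k) * cnj (U $$ (j, l))))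
      sums (\<Sum>l<n. U $$ (i, l) * exp (c * f l) * cnj (U $$ (j, l)))"
      by (intro sums_sum sums_mult sums_mult2 exp_converges)
    moreover have "(?A ^\<^sub>m k) $$ (i, j) / fact k = (\<Sum>l<n. U $$ (i, l) * ((c * f l) ^ k /\<^sub>R fact k) * cnj (U $$ (j, l)))" for k
      unfolding pow conj_mat_diag_index[OF Uc ij]
      by (simp add: sum_divide_distrib scaleR_conv_of_real divide_simps)
    ultimately have "(\<Sum>k. (?A ^\<^sub>m k) $$ (i, j) / fact k) = (\<Sum>l<n. U $$ (i, l) * exp (c * f l) * cnj (U $$ (j, l)))"
      by (simp add: sums_iff)
    then show "mat_exp ?A $$ (i, j) = (U * mat_diag n (\<lambda>i. exp (c * f i)) * mat_adjoint U) $$ (i, j)"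
      using ij Uc by (simp add: mat_exp_def conj_mat_diag_index del: index_mult_mat(1))
  qed (use Uc in \<open>auto simp: mat_exp_def\<close>)
qed

lemma phase_unitary_carrier: "T \<in> carrier_mat n n \<Longrightarrow> phase_unitary T \<theta> \<in> carrier_mat n n"
  by (simp add: phase_unitary_def mat_exp_def)

text \<open>The definition of \<open>phase_channel\<close> has a second exponential on the right. In
  an eigenbasis of \<open>T\<close>, whose eigenvalues are real, it is seen to be the adjoint of
  \<open>phase_unitary\<close>.\<close>

lemma phase_channel_conj:
  assumes "hermitian_mat n T"
  shows "phase_channel T \<theta> X = phase_unitary T \<theta> * X * mat_adjoint (phase_unitary T \<theta>)"
proof -
  obtain U d where U: "unitary_mat n U" and T: "T = U * mat_diag n (\<lambda>i. of_real (d i)) * mat_adjoint U"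
    using hermitian_diagonalization[OF assms] by blast
  have "cnj (exp (- (\<i> * of_real \<theta> * of_real (d i)))) = exp (\<i> * of_real \<theta> * of_real (d i))" for i
    using cis_cnj[of "- (\<theta> * d i)"] by (simp add: cis_conv_exp mult_ac)
  moreover have "U \<in> carrier_mat n n" using U by (simp add: unitary_mat_def)
  ultimately have "mat_adjoint (phase_unitary T \<theta>) = mat_exp ((\<i> * of_real \<theta>) \<cdot>\<^sub>m T)"
    unfolding phase_unitary_def T mat_exp_conj_mat_diag[OF U]
    by (simp add: mat_adjoint_conj_mat_diag)
  then show ?thesis by (simp add: phase_channel_def)
qed

text \<open>In the eigenbasis of \<open>T\<close>, the coordinates \<open>w\<close> of
  \<open>v\<close> vanish unless \<open>d i = e\<close>, so all phases that act on nonzero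
  coordinates coincide.\<close>

lemma phase_unitary_eigenvector:
  assumes T: "hermitian_mat n T" and v: "v \<in> carrier_vec n" and ev: "T *\<^sub>v v = complex_of_real e \<cdot>\<^sub>v v"
  shows "phase_unitary T \<theta> *\<^sub>v v = cis (- (\<theta> * e)) \<cdot>\<^sub>v v"
proof -
  obtain U d where U: "unitary_mat n U" and TU: "T = U * mat_diag n (\<lambda>i. of_real (d i)) * mat_adjoint U"
    using hermitian_diagonalization[OF T] by blast
  have c: "U \<in> carrier_mat n n" "mat_adjoint U \<in> carrier_mat n n" "T \<in> carrier_mat n n"
    using U T by (auto simp: unitary_mat_def hermitian_mat_def)
  let ?D = "mat_diag n (\<lambda>i. complex_of_real (d i))"
    and ?E = "mat_diag n (\<lambda>i. exp (- \<i> * of_real \<theta> * complex_of_real (d i)))"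
  define w where "w = mat_adjoint U *\<^sub>v v"
  have w: "w \<in> carrier_vec n" using c v by (simp add: w_def)
  have Uw: "U *\<^sub>v w = v"
  proof -
    have "U *\<^sub>v w = (U * mat_adjoint U) *\<^sub>v v" using c v by (simp add: w_def assoc_mult_mat_vec[of _ n n _ n])
    then show ?thesis using U v by (simp add: unitary_mat_def)
  qed
  have diag: "(mat_diag n f *\<^sub>v w) $ i = f i * w $ i" if "i < n" for f i
    using that w by (simp add: mat_diag_def scalar_prod_def if_distrib[of "\<lambda>x. x * _"] cong: if_cong)
  have "mat_adjoint U *\<^sub>v (T *\<^sub>v v) = (mat_adjoint U * U) *\<^sub>v (?D *\<^sub>v w)"
    using c v w by (simp add: TU w_def assoc_mult_mat_vec[of _ n n _ n])
  also have "\<dots> = ?D *\<^sub>v w" using U w by (simp add: unitary_mat_def)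
  finally have Dw: "?D *\<^sub>v w = of_real e \<cdot>\<^sub>v w"
    unfolding ev using c v by (simp add: w_def mult_mat_vec[of _ n n])
  have dw: "complex_of_real (d i) * w $ i = of_real e * w $ i" if "i < n" for i
  proof -
    have "complex_of_real (d i) * w $ i = (?D *\<^sub>v w) $ i" by (rule diag[OF that, symmetric])
    also have "\<dots> = of_real e * w $ i" unfolding Dw using that w by simp
    finally show ?thesis .
  qed
  have "?E *\<^sub>v w = cis (- (\<theta> * e)) \<cdot>\<^sub>v w"
  proof (rule eq_vecI)
    fix i assume "i < dim_vec (cis (- (\<theta> * e)) \<cdot>\<^sub>v w)"
    then have i: "i < n" using w by simp
    show "(?E *\<^sub>v w) $ i = (cis (- (\<theta> * e)) \<cdot>\<^sub>v w) $ i"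
    proof (cases "w $ i = 0")
      case False
      then have "d i = e" using dw[OF i] by simp
      then show ?thesis using i w unfolding diag[OF i] by (simp add: cis_conv_exp mult_ac)
    qed (use i w in \<open>unfold diag[OF i], simp\<close>)
  qed (use w in simp)
  then have "U *\<^sub>v (?E *\<^sub>v w) = cis (- (\<theta> * e)) \<cdot>\<^sub>v v"
    using c w Uw by (simp add: mult_mat_vec[of _ n n])
  moreover have "phase_unitary T \<theta> *\<^sub>v v = U *\<^sub>v (?E *\<^sub>v w)"
    unfolding phase_unitary_def TU mat_exp_conj_mat_diag[OF U]
    using c v by (simp add: w_def assoc_mult_mat_vec[of _ n n _ n])
  ultimately show ?thesis by simp
qed

text \<open>Obtained by moving \<open>T\<close> across the inner product. With \<open>v = w\<close>
  it shows that eigenvalues are real, with distinct real eigenvalues that eigenvectors are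
  orthogonal.\<close>

lemma hermitian_eigenvectors:
  assumes T: "hermitian_mat n T" and v: "v \<in> carrier_vec n" "T *\<^sub>v v = a \<cdot>\<^sub>v v"
    and w: "w \<in> carrier_vec n" "T *\<^sub>v w = b \<cdot>\<^sub>v w"
  shows "a * (v \<bullet>c w) = cnj b * (v \<bullet>c w)"
proof -
  have c: "T \<in> carrier_mat n n" "mat_adjoint T = T" using T by (auto simp: hermitian_mat_def)
  have "(a \<cdot>\<^sub>v v) \<bullet>c w = v \<bullet>c (b \<cdot>\<^sub>v w)"
    using cscalar_prod_adjoint[OF c(1) w(1) v(1)] by (simp add: c(2) v(2) w(2))
  then show ?thesis using v w by (simp add: conjugate_smult_vec)
qed

lemma hermitian_spectrum:
  assumes T: "hermitian_mat n T" and e: "e \<in> spectrum T"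
  shows "\<exists>v. v \<in> carrier_vec n \<and> v \<bullet>c v = 1 \<and> T *\<^sub>v v = of_real (Re e) \<cdot>\<^sub>v v"
proof -
  have Tc: "T \<in> carrier_mat n n" using T by (simp add: hermitian_mat_def)
  obtain u where u: "u \<in> carrier_vec n" "u \<noteq> 0\<^sub>v n" "T *\<^sub>v u = e \<cdot>\<^sub>v u"
    using e Tc by (auto simp: spectrum_def eigenvalue_def eigenvector_def)
  have u0: "u \<bullet>c u \<noteq> 0" using u by simp
  then have "e = cnj e" using hermitian_eigenvectors[OF T u(1,3) u(1,3)] by simp
  then have eR: "e = of_real (Re e)" by (simp add: complex_eq_iff)
  have "0 \<le> u \<bullet>c u" by (rule conjugate_square_ge_0_vec)
  then have ur: "u \<bullet>c u = of_real (Re (u \<bullet>c u))" "Re (u \<bullet>c u) \<ge> 0"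
    by (auto simp: less_eq_complex_def complex_eq_iff)
  define r where "r = sqrt (Re (u \<bullet>c u))"
  have rr: "u \<bullet>c u = of_real r * of_real r" using ur by (simp add: r_def flip: of_real_mult)
  define v where "v = complex_of_real (1 / r) \<cdot>\<^sub>v u"
  have "v \<in> carrier_vec n" using u by (simp add: v_def)
  moreover have "v \<bullet>c v = 1"
    using u u0 rr by (auto simp add: v_def conjugate_smult_vec)
  moreover have "T *\<^sub>v v = of_real (Re e) \<cdot>\<^sub>v v"
    using u Tc eR by (simp add: v_def mult_mat_vec[of _ n n] smult_smult_assoc mult.commute)
  ultimately show ?thesis by blast
qed

lemma eigenvalue_spread_eigenvectors:
  assumes T: "hermitian_mat n T" and n: "n > 0"
  shows "\<exists>a b v w. eigenvalue_spread T = a - b \<and> a \<ge> b \<and>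
    v \<in> carrier_vec n \<and> v \<bullet>c v = 1 \<and> T *\<^sub>v v = of_real a \<cdot>\<^sub>v v \<and>
    w \<in> carrier_vec n \<and> w \<bullet>c w = 1 \<and> T *\<^sub>v w = of_real b \<cdot>\<^sub>v w"
proof -
  have Tc: "T \<in> carrier_mat n n" using T by (simp add: hermitian_mat_def)
  have fin: "finite (Re ` spectrum T)" using card_finite_spectrum(1)[OF Tc] by simp
  have ne: "Re ` spectrum T \<noteq> {}" using spectrum_non_empty[OF Tc n] by simp
  obtain a where a: "a \<in> spectrum T" "Re a = Max (Re ` spectrum T)"
    using Max_in[OF fin ne] by (metis imageE)
  obtain b where b: "b \<in> spectrum T" "Re b = Min (Re ` spectrum T)"
    using Min_in[OF fin ne] by (metis imageE)
  have "Re b \<le> Re a" unfolding b(2) using fin a(1) by simp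
  then show ?thesis
    using hermitian_spectrum[OF T a(1)] hermitian_spectrum[OF T b(1)] a b
    unfolding eigenvalue_spread_def by metis
qed

section \<open>Reference systems and the channel fidelity\<close>

lemma ext_id_one:
  assumes "X \<in> carrier_mat n n" "E X \<in> carrier_mat n n"
  shows "ext_id n 1 E X = E X"
proof -
  have "ref_block n 1 X 0 0 = X" using assms by (intro eq_matI) (auto simp: ref_block_def)
  then show ?thesis using assms by (intro eq_matI) (auto simp: ext_id_def)
qed

text \<open>A unitary evolution next to an idle reference keeps the joint state pure. This gives
  positivity of the ideal output for every reference dimension, hence nonnegative
  fidelities.\<close>

lemma ext_id_conj_pure_state:
  assumes V: "V \<in> carrier_mat n n" and v: "v \<in> carrier_vec (n * m)"
  shows "\<exists>y\<in>carrier_vec (n * m). ext_id n m (\<lambda>X. V * X * mat_adjoint V) (pure_state v) = pure_state y"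
proof
  \<comment> \<open>\<open>x a\<close> is the component of \<open>v\<close> along the reference
    basis vector with index \<open>a\<close>; \<open>y\<close> reassembles these components after
    \<open>V\<close> has acted on each.\<close>
  define x where "x = (\<lambda>a. vec n (\<lambda>k. v $ (k * m + a)))"
  define y where "y = vec (n * m) (\<lambda>r. (V *\<^sub>v x (r mod m)) $ (r div m))"
  show "y \<in> carrier_vec (n * m)" by (simp add: y_def)
  have *: "(V * ref_block n m (pure_state v) a b * mat_adjoint V) $$ (i, j) = (V *\<^sub>v x a) $ i * cnj ((V *\<^sub>v x b) $ j)"
    if ij: "i < n" "j < n" and ab: "a < m" "b < m" for a b i j
  proof -
    have lt: "k * m + c < n * m" if "k < n" "c < m" for k c
    proof -
      have "k * m + c < Suc k * m" using that by simp
      also have "\<dots> \<le> n * m" using that by (intro mult_right_mono) auto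
      finally show ?thesis .
    qed
    have R: "ref_block n m (pure_state v) a b \<in> carrier_mat n n" by (simp add: ref_block_def)
    have 1: "(V * ref_block n m (pure_state v) a b) $$ (i, l) = (V *\<^sub>v x a) $ i * cnj (x b $ l)" if "l < n" for l
      using V v ij that ab lt R
      by (subst mat_mult_index[of _ n n])
         (auto simp: ref_block_def pure_state_def x_def scalar_prod_def atLeast0LessThan sum_distrib_right intro!: sum.cong)
    have "(V * ref_block n m (pure_state v) a b * mat_adjoint V) $$ (i, j)
        = (\<Sum>l<n. (V *\<^sub>v x a) $ i * (cnj (x b $ l) * cnj (V $$ (j, l))))"
      using V ij R 1 by (subst mat_mult_index[of _ n n]) (auto intro!: sum.cong)
    also have "\<dots> = (V *\<^sub>v x a) $ i * cnj ((V *\<^sub>v x b) $ j)"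
      using V ij by (auto simp: x_def scalar_prod_def atLeast0LessThan sum_distrib_left mult_ac intro!: sum.cong)
    finally show ?thesis .
  qed
  show "ext_id n m (\<lambda>X. V * X * mat_adjoint V) (pure_state v) = pure_state y"
  proof (rule eq_matI)
    fix r s assume "r < dim_row (pure_state y)" "s < dim_col (pure_state y)"
    then have rs: "r < n * m" "s < n * m" by (auto simp: pure_state_def y_def)
    then have m: "m > 0" by (cases m) auto
    have "r div m < n" "s div m < n" "r mod m < m" "s mod m < m"
      using rs m by (auto simp: less_mult_imp_div_less)
    then show "ext_id n m (\<lambda>X. V * X * mat_adjoint V) (pure_state v) $$ (r, s) = pure_state y $$ (r, s)"
      using rs * by (simp add: ext_id_def pure_state_def[of y]) (simp add: y_def)
  qed (auto simp: ext_id_def pure_state_def y_def)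
qed

text \<open>The trivial reference \<open>m = 1\<close> contributes one member to the set, which
  bounds the infimum from above. Nonnegativity of all members gives the lower bound, and also the
  boundedness without which a real infimum is not below its members.\<close>

lemma channel_fidelity_bounds:
  assumes C: "channel n C" and V: "V \<in> carrier_mat n n" and v: "v \<in> carrier_vec n" "v \<bullet>c v = 1"
    and D: "D = (\<lambda>X. V * X * mat_adjoint V)"
  shows "0 \<le> channel_fidelity n C D"
    and "channel_fidelity n C D \<le> sqrt (Re (sandwich (C (pure_state v)) (V *\<^sub>v v) (V *\<^sub>v v)))"
proof -
  let ?S = "{fidelity (ext_id n m C (pure_state v)) (ext_id n m D (pure_state v)) | m v.
            m > 0 \<and> v \<in> carrier_vec (n * m) \<and> v \<bullet>c v = 1}"
  have cp: "completely_positive n C" using C by (simp add: channel_def)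
  have nonneg: "0 \<le> x" if mem: "x \<in> ?S" for x
  proof -
    obtain m v where x: "x = fidelity (ext_id n m C (pure_state v)) (ext_id n m D (pure_state v))"
      and v: "v \<in> carrier_vec (n * m)" using mem by blast
    have "psd_mat (n * m) (ext_id n m C (pure_state v))"
      using cp psd_pure_state[OF v] by (simp add: completely_positive_def)
    moreover have "psd_mat (n * m) (ext_id n m D (pure_state v))"
      using ext_id_conj_pure_state[OF V v] psd_pure_state unfolding D by metis
    ultimately show ?thesis unfolding x by (rule fidelity_nonneg)
  qed
  have P: "pure_state v \<in> carrier_mat n n" using v(1) by (rule pure_state_carrier)
  have CP: "C (pure_state v) \<in> carrier_mat n n"
    using C P by (simp add: channel_def linear_superop_def)
  have CP1: "ext_id n 1 C (pure_state v) = C (pure_state v)"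
    using P CP by (rule ext_id_one[of _ n C])
  have "psd_mat (n * 1) (ext_id n 1 C (pure_state v))"
    using cp[unfolded completely_positive_def, rule_format, of 1] psd_pure_state[of v n] v(1) by simp
  then have psd: "psd_mat n (C (pure_state v))" unfolding CP1 by simp
  have "D (pure_state v) = pure_state (V *\<^sub>v v)" unfolding D by (rule conj_pure_state[OF v(1) V])
  moreover have "V *\<^sub>v v \<in> carrier_vec n" using V v by simp
  ultimately have DP1: "ext_id n 1 D (pure_state v) = pure_state (V *\<^sub>v v)"
    using ext_id_one[of "pure_state v" n D] P pure_state_carrier by simp
  then have fid: "fidelity (ext_id n 1 C (pure_state v)) (ext_id n 1 D (pure_state v))
      = sqrt (Re (sandwich (C (pure_state v)) (V *\<^sub>v v) (V *\<^sub>v v)))"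
    unfolding CP1 DP1 using V v by (intro fidelity_pure_state[OF psd]) simp
  have mem: "sqrt (Re (sandwich (C (pure_state v)) (V *\<^sub>v v) (V *\<^sub>v v))) \<in> ?S"
    using v fid[symmetric] by (intro CollectI exI[of _ 1] exI[of _ v]) simp
  show "0 \<le> channel_fidelity n C D"
    unfolding channel_fidelity_def using mem nonneg by (intro cInf_greatest) blast+
  show "channel_fidelity n C D \<le> sqrt (Re (sandwich (C (pure_state v)) (V *\<^sub>v v) (V *\<^sub>v v)))"
    unfolding channel_fidelity_def using nonneg by (intro cInf_lower mem bdd_belowI) blast
qed

section \<open>Coherence between two orthonormal vectors\<close>

definition outer_prod :: "complex vec \<Rightarrow> complex vec \<Rightarrow> complex mat" where
  "outer_prod v w = mat (dim_vec v) (dim_vec w) (\<lambda>(i, j). v $ i * cnj (w $ j))"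

lemma outer_prod_carrier [simp]:
  "v \<in> carrier_vec n \<Longrightarrow> w \<in> carrier_vec m \<Longrightarrow> outer_prod v w \<in> carrier_mat n m"
  by (simp add: outer_prod_def)

lemma outer_prod_mult:
  assumes "v \<in> carrier_vec n" "w \<in> carrier_vec n" "x \<in> carrier_vec n" "y \<in> carrier_vec n"
  shows "outer_prod v w * outer_prod x y = (x \<bullet>c w) \<cdot>\<^sub>m outer_prod v y"
proof (rule eq_matI)
  fix i j assume "i < dim_row ((x \<bullet>c w) \<cdot>\<^sub>m outer_prod v y)" "j < dim_col ((x \<bullet>c w) \<cdot>\<^sub>m outer_prod v y)"
  then have ij: "i < n" "j < n" using assms by (auto simp: outer_prod_def)
  then show "(outer_prod v w * outer_prod x y) $$ (i, j) = ((x \<bullet>c w) \<cdot>\<^sub>m outer_prod v y) $$ (i, j)"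
    using assms by (simp add: outer_prod_def cscalar_prod_sum[of w n] sum_distrib_right)
      (auto simp: scalar_prod_def atLeast0LessThan mult_ac intro!: sum.cong)
qed (use assms in \<open>auto simp: outer_prod_def\<close>)

lemma mat_trace_mult_outer_prod:
  assumes "A \<in> carrier_mat n n" "v \<in> carrier_vec n" "w \<in> carrier_vec n"
  shows "mat_trace (A * outer_prod v w) = sandwich A w v"
proof -
  have "mat_trace (A * outer_prod v w) = (\<Sum>i<n. \<Sum>k<n. A $$ (i, k) * v $ k * cnj (w $ i))"
    using assms by (simp add: mat_trace_def outer_prod_def scalar_prod_def atLeast0LessThan mult.assoc)
  then show ?thesis using assms by (simp add: sandwich_sum[of _ n])
qed

lemma sandwich_hermitian_swap:
  assumes "hermitian_mat n A" "v \<in> carrier_vec n" "w \<in> carrier_vec n"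
  shows "sandwich A w v = cnj (sandwich A v w)"
proof -
  have c: "A \<in> carrier_mat n n" "mat_adjoint A = A" using assms by (auto simp: hermitian_mat_def)
  show ?thesis
    using cscalar_prod_adjoint[OF c(1) assms(3,2)] cscalar_prod_swap[of v n "A *\<^sub>v w"] c assms
    by (simp add: sandwich_def)
qed

lemma hermitian_outer_prod_pair:
  assumes "v \<in> carrier_vec n" "w \<in> carrier_vec n"
  shows "hermitian_mat n (c \<cdot>\<^sub>m outer_prod w v + cnj c \<cdot>\<^sub>m outer_prod v w)"
  by (rule hermitian_matI) (use assms in \<open>auto simp: outer_prod_def mult_ac\<close>)

lemma hermitian_outer_prod_add:
  assumes "v \<in> carrier_vec n" "w \<in> carrier_vec n"
  shows "hermitian_mat n (outer_prod v v + outer_prod w w)"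
  by (rule hermitian_matI) (use assms in \<open>auto simp: outer_prod_def mult_ac\<close>)

lemma mat_add_square:
  assumes "A \<in> carrier_mat n n" "B \<in> carrier_mat n n"
  shows "(A + B) * (A + B) = (A * A + A * B) + (B * A + B * B)"
  using assms
  by (simp add: add_mult_distrib_mat[of A n n B "A + B" n]
      mult_add_distrib_mat[of A n n A n B] mult_add_distrib_mat[of B n n A n B])

text \<open>On the span of \<open>v\<close> and \<open>w\<close> the operator \<open>K\<close> is a
  purely off-diagonal 2 by 2 matrix, so its square is a multiple of the projection onto that
  span.\<close>

lemma outer_prod_pair_square:
  fixes c :: complex
  assumes "v \<in> carrier_vec n" "w \<in> carrier_vec n" "v \<bullet>c v = 1" "w \<bullet>c w = 1" "v \<bullet>c w = 0"
  defines "K \<equiv> c \<cdot>\<^sub>m outer_prod w v + cnj c \<cdot>\<^sub>m outer_prod v w"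
  shows "K * K = complex_of_real ((cmod c)\<^sup>2) \<cdot>\<^sub>m (outer_prod v v + outer_prod w w)"
proof -
  have wv: "w \<bullet>c v = 0" using cscalar_prod_swap[of w n v] assms by simp
  let ?A = "c \<cdot>\<^sub>m outer_prod w v" and ?B = "cnj c \<cdot>\<^sub>m outer_prod v w"
  have ABc: "?A \<in> carrier_mat n n" "?B \<in> carrier_mat n n" using assms by auto
  have "K * K = (?A * ?A + ?A * ?B) + (?B * ?A + ?B * ?B)"
    unfolding K_def using ABc by (rule mat_add_square)
  also have "\<dots> = complex_of_real ((cmod c)\<^sup>2) \<cdot>\<^sub>m (outer_prod v v + outer_prod w w)"
    using assms(1-5) wv
    by (simp add: mult_smult_distrib[of _ n n _ n] mult_smult_assoc_mat[of _ n n _ n] outer_prod_mult[of _ n])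
       (intro eq_matI, auto simp: outer_prod_def of_real_cmod_square algebra_simps)
  finally show ?thesis .
qed

lemma outer_prod_projection:
  assumes "v \<in> carrier_vec n" "w \<in> carrier_vec n" "v \<bullet>c v = 1" "w \<bullet>c w = 1" "v \<bullet>c w = 0"
  defines "P \<equiv> outer_prod v v + outer_prod w w"
  shows "P * P = P"
proof -
  have wv: "w \<bullet>c v = 0" using cscalar_prod_swap[of w n v] assms by simp
  let ?A = "outer_prod v v" and ?B = "outer_prod w w"
  have ABc: "?A \<in> carrier_mat n n" "?B \<in> carrier_mat n n" using assms by auto
  have "P * P = (?A * ?A + ?A * ?B) + (?B * ?A + ?B * ?B)"
    unfolding P_def using ABc by (rule mat_add_square)
  also have "\<dots> = P"
    using assms(1-5) wv unfolding P_def
    by (simp add: outer_prod_mult[of _ n]) (intro eq_matI, auto simp: outer_prod_def)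
  finally show ?thesis .
qed

lemma sandwich_le_trace:
  assumes "psd_mat n \<sigma>" "v \<in> carrier_vec n" "v \<bullet>c v = 1"
  shows "Re (sandwich \<sigma> v v) \<le> Re (mat_trace \<sigma>)"
proof -
  have "hermitian_mat n (outer_prod v v)"
    by (rule hermitian_matI) (use assms in \<open>auto simp: outer_prod_def mult_ac\<close>)
  moreover have "outer_prod v v * outer_prod v v = outer_prod v v"
    using assms by (simp add: outer_prod_mult[of _ n]) (intro eq_matI, auto simp: outer_prod_def)
  ultimately show ?thesis
    using trace_projection_le[OF assms(1)] mat_trace_mult_outer_prod[OF psd_mat_carrier[OF assms(1)] assms(2,2)]
    by metis
qed

text \<open>The populations of two orthonormal vectors in a state add up to at most 1. This bounds
  the quadratic term of the variational bound and also the overlap with the ideal output.\<close>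

lemma sandwich_pair_le_trace:
  assumes "psd_mat n \<sigma>" "v \<in> carrier_vec n" "w \<in> carrier_vec n" "v \<bullet>c v = 1" "w \<bullet>c w = 1" "v \<bullet>c w = 0"
  shows "mat_trace (\<sigma> * (outer_prod v v + outer_prod w w)) = sandwich \<sigma> v v + sandwich \<sigma> w w"
    and "Re (sandwich \<sigma> v v) + Re (sandwich \<sigma> w w) \<le> Re (mat_trace \<sigma>)"
proof -
  have c: "\<sigma> \<in> carrier_mat n n" using assms(1) by (rule psd_mat_carrier)
  show *: "mat_trace (\<sigma> * (outer_prod v v + outer_prod w w)) = sandwich \<sigma> v v + sandwich \<sigma> w w"
    using c assms(2,3)
    by (simp add: mult_add_distrib_mat[of _ n n _ n] mat_trace_add[of _ n] mat_trace_mult_outer_prod[of _ n])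
  show "Re (sandwich \<sigma> v v) + Re (sandwich \<sigma> w w) \<le> Re (mat_trace \<sigma>)"
    using trace_projection_le[OF assms(1) hermitian_outer_prod_add[OF assms(2,3)] outer_prod_projection[OF assms(2-)]] *
    by simp
qed

text \<open>The linear term of the variational bound sees only the matrix element of
  \<open>D\<close> between \<open>v\<close> and \<open>w\<close>, and the quadratic term is at most
  \<open>(cmod c)\<^sup>2\<close>. The coefficient \<open>c\<close> stays free, to be adapted to the
  direction in which the coherence moves.\<close>

lemma qfi_coherence_bound:
  assumes psd: "\<And>t. t \<in> {a..b} \<Longrightarrow> psd_mat n (f t)" and tr: "mat_trace (f \<theta>) = 1" and \<theta>: "a < \<theta>" "\<theta> < b"
    and der: "has_mat_derivative n f D (at \<theta> within {a..b})"
    and vw: "v \<in> carrier_vec n" "w \<in> carrier_vec n" "v \<bullet>c v = 1" "w \<bullet>c w = 1" "v \<bullet>c w = 0"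
  shows "\<exists>q. has_qfi n f {a..b} \<theta> q \<and> 4 * Re (c * sandwich D v w) - (cmod c)\<^sup>2 \<le> q"
proof -
  have D: "hermitian_mat n D"
    by (rule has_mat_derivative_hermitian[OF der \<theta> psd_mat_hermitian[OF psd]])
  have Dc: "D \<in> carrier_mat n n" using D by (simp add: hermitian_mat_def)
  define K where "K = c \<cdot>\<^sub>m outer_prod w v + cnj c \<cdot>\<^sub>m outer_prod v w"
  have K: "hermitian_mat n K" unfolding K_def using vw by (intro hermitian_outer_prod_pair)
  have p: "psd_mat n (f \<theta>)" using psd \<theta> by simp
  obtain q where q: "has_qfi n f {a..b} \<theta> q"
    and le: "2 * Re (mat_trace (D * K)) - Re (mat_trace (f \<theta> * (K * K))) \<le> q"
    using qfi_variational_bound[OF psd \<theta> der] K by blast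
  have "mat_trace (D * K) = c * sandwich D v w + cnj c * sandwich D w v"
    unfolding K_def using Dc vw
    by (simp add: mult_add_distrib_mat[of _ n n _ n] mat_trace_add[of _ n] mat_trace_smult[of _ n]
        mult_smult_distrib[of _ n n _ n] mat_trace_mult_outer_prod[of _ n])
  also have "\<dots> = c * sandwich D v w + cnj (c * sandwich D v w)"
    using sandwich_hermitian_swap[OF D vw(1,2)] by simp
  finally have DK: "Re (mat_trace (D * K)) = 2 * Re (c * sandwich D v w)" by simp
  have "f \<theta> * (K * K) = complex_of_real ((cmod c)\<^sup>2) \<cdot>\<^sub>m (f \<theta> * (outer_prod v v + outer_prod w w))"
    unfolding K_def outer_prod_pair_square[OF vw] using psd_mat_carrier[OF p] vw
    by (intro mult_smult_distrib[of _ n n _ n]) auto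
  then have "mat_trace (f \<theta> * (K * K)) = complex_of_real ((cmod c)\<^sup>2) * (sandwich (f \<theta>) v v + sandwich (f \<theta>) w w)"
    using psd_mat_carrier[OF p] vw by (simp add: mat_trace_smult[of _ n] sandwich_pair_le_trace(1)[OF p vw])
  then have "Re (mat_trace (f \<theta> * (K * K))) = (cmod c)\<^sup>2 * (Re (sandwich (f \<theta>) v v) + Re (sandwich (f \<theta>) w w))"
    by (simp only: Re_complex_of_real Im_complex_of_real times_complex.sel plus_complex.sel)
  also have "\<dots> \<le> (cmod c)\<^sup>2 * 1"
    using sandwich_pair_le_trace(2)[OF p vw] tr by (intro mult_left_mono) auto
  finally show ?thesis using q le DK by (intro exI[of _ q]) auto
qed

text \<open>The quotient \<open>Im (g t) / Re (g t)\<close> is the tangent of the argument of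
  \<open>g t\<close>, which avoids choosing a branch. Where its derivative vanishes, the quotient
  rule says that \<open>g' t\<close> is parallel to \<open>g t\<close>.\<close>

lemma radial_derivative_exists:
  fixes g :: "real \<Rightarrow> complex"
  assumes ab: "a < b" and der: "\<And>t. t \<in> {a..b} \<Longrightarrow> (g has_vector_derivative g' t) (at t within {a..b})"
    and pos: "\<And>t. t \<in> {a..b} \<Longrightarrow> Re (g t) > 0" and eq: "g a = g b"
  shows "\<exists>t k. a < t \<and> t < b \<and> g' t = of_real k * g t"
proof -
  let ?F = "\<lambda>t. Im (g t) / Re (g t)"
  have d: "(?F has_real_derivative (Im (g' t) * Re (g t) - Im (g t) * Re (g' t)) / (Re (g t) * Re (g t))) (at t within {a..b})"
    if "t \<in> {a..b}" for t
    using der[OF that] pos[OF that] by (intro DERIV_divide) (auto simp: has_vector_derivative_complex_iff)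
  have "\<exists>z>a. z < b \<and> DERIV ?F z :> 0"
  proof (rule Rolle[OF ab])
    show "continuous_on {a..b} ?F"
      using d by (intro DERIV_continuous_on) auto
    fix t assume "a < t" "t < b"
    then show "?F differentiable (at t)"
      using d[of t] by (auto simp: at_within_Icc_at real_differentiable_def)
  qed (simp add: eq)
  then obtain t where t: "a < t" "t < b" "DERIV ?F t :> 0" by blast
  have "DERIV ?F t :> (Im (g' t) * Re (g t) - Im (g t) * Re (g' t)) / (Re (g t) * Re (g t))"
    using d[of t] t by (simp add: at_within_Icc_at)
  from DERIV_unique[OF this t(3)] have "Im (g' t) * Re (g t) = Im (g t) * Re (g' t)"
    using pos[of t] t by auto
  then have "g' t = of_real (Re (g' t) / Re (g t)) * g t"
    using pos[of t] t by (auto simp: complex_eq_iff field_simps)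
  then show ?thesis using t by blast
qed

section \<open>Deviation from the ideal channel and the final bound\<close>

lemma channel_psd:
  assumes C: "channel n C" and \<rho>: "psd_mat n \<rho>"
  shows "psd_mat n (C \<rho>)"
proof -
  have c: "\<rho> \<in> carrier_mat n n" using \<rho> by (rule psd_mat_carrier)
  then have "C \<rho> \<in> carrier_mat n n" using C by (simp add: channel_def linear_superop_def)
  then have "ext_id n 1 C \<rho> = C \<rho>" using c by (intro ext_id_one[of _ n C])
  moreover have "psd_mat (n * 1) (ext_id n 1 C \<rho>)"
    using C \<rho> unfolding channel_def completely_positive_def by (metis mult_1_right)
  ultimately show ?thesis by simp
qed

lemma density_pure_state:
  "v \<in> carrier_vec n \<Longrightarrow> v \<bullet>c v = 1 \<Longrightarrow> density_operator n (pure_state v)"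
  by (simp add: density_operator_def psd_pure_state mat_trace_pure_state)

lemma channel_density:
  assumes "channel n C" "density_operator n \<rho>"
  shows "density_operator n (C \<rho>)"
proof -
  have "psd_mat n \<rho>" "mat_trace \<rho> = 1" using assms(2) by (auto simp: density_operator_def)
  then show ?thesis
    using channel_psd[OF assms(1)] assms(1) psd_mat_carrier[of n \<rho>]
    by (auto simp: density_operator_def channel_def)
qed

lemma orthonormal_combination_norm:
  fixes v w :: "complex vec"
  assumes "v \<in> carrier_vec n" "w \<in> carrier_vec n" "v \<bullet>c v = 1" "w \<bullet>c w = 1" "v \<bullet>c w = 0"
    and "c * cnj c + d * cnj d = 1"
  shows "(c \<cdot>\<^sub>v v + d \<cdot>\<^sub>v w) \<bullet>c (c \<cdot>\<^sub>v v + d \<cdot>\<^sub>v w) = 1"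
proof -
  have wv: "w \<bullet>c v = 0" using cscalar_prod_swap[of w n v] assms by simp
  have "(c \<cdot>\<^sub>v v + d \<cdot>\<^sub>v w) \<bullet>c (c \<cdot>\<^sub>v v + d \<cdot>\<^sub>v w)
    = c * cnj c * (v \<bullet>c v) + c * cnj d * (v \<bullet>c w) + d * cnj c * (w \<bullet>c v) + d * cnj d * (w \<bullet>c w)"
    using assms(1,2)
    by (simp add: cscalar_prod_sum[of _ n] algebra_simps sum.distrib sum_distrib_left)
  then show ?thesis using assms wv by simp
qed

lemma sandwich_combination:
  assumes A: "hermitian_mat n A" and v: "v \<in> carrier_vec n" "w \<in> carrier_vec n"
  shows "Re (sandwich A (c \<cdot>\<^sub>v v + d \<cdot>\<^sub>v w) (c \<cdot>\<^sub>v v + d \<cdot>\<^sub>v w))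
     = (cmod c)\<^sup>2 * Re (sandwich A v v) + (cmod d)\<^sup>2 * Re (sandwich A w w) + 2 * Re (cnj c * d * sandwich A v w)"
proof -
  have Ac: "A \<in> carrier_mat n n" using A by (simp add: hermitian_mat_def)
  have "sandwich A (c \<cdot>\<^sub>v v + d \<cdot>\<^sub>v w) (c \<cdot>\<^sub>v v + d \<cdot>\<^sub>v w)
     = of_real ((cmod c)\<^sup>2) * sandwich A v v + of_real ((cmod d)\<^sup>2) * sandwich A w w
       + (cnj c * d * sandwich A v w + cnj (cnj c * d * sandwich A v w))"
    using Ac v sandwich_hermitian_swap[OF A v]
    by (simp add: sandwich_add_left[of _ n] sandwich_add_right[of _ n] sandwich_smult_left[of _ n]
        sandwich_smult_right[of _ n] of_real_cmod_square algebra_simps)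
  then have "Re (sandwich A (c \<cdot>\<^sub>v v + d \<cdot>\<^sub>v w) (c \<cdot>\<^sub>v v + d \<cdot>\<^sub>v w))
     = Re (of_real ((cmod c)\<^sup>2) * sandwich A v v) + Re (of_real ((cmod d)\<^sup>2) * sandwich A w w)
       + 2 * Re (cnj c * d * sandwich A v w)" by (simp only: plus_complex.sel cnj.sel mult_2)
  moreover have "Re (of_real r * z) = r * Re z" for r z by simp
  ultimately show ?thesis by presburger
qed

text \<open>With \<open>F\<close> the channel fidelity and \<open>s\<close> the overlap of the
  output with the ideal output \<open>u\<close>, one has \<open>x = 1 - F\<close> and
  \<open>F\<^sup>2 \<le> s\<close>; the estimate drops \<open>x\<^sup>2\<close> from the square of
  \<open>1 - x\<close>.\<close>

lemma bures_distance_square: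
  assumes C: "channel n C" and T: "hermitian_mat n T" and v: "v \<in> carrier_vec n" "v \<bullet>c v = 1"
    and unit: "(phase_unitary T \<theta> *\<^sub>v v) \<bullet>c (phase_unitary T \<theta> *\<^sub>v v) = 1"
  defines "x \<equiv> (bures_distance n C (phase_channel T \<theta>))\<^sup>2"
  shows "0 \<le> x" "x \<le> 1"
    and "1 - 2 * x \<le> Re (sandwich (C (pure_state v)) (phase_unitary T \<theta> *\<^sub>v v) (phase_unitary T \<theta> *\<^sub>v v))"
proof -
  define u where "u = phase_unitary T \<theta> *\<^sub>v v"
  define F where "F = channel_fidelity n C (phase_channel T \<theta>)"
  define s where "s = Re (sandwich (C (pure_state v)) u u)"
  have V: "phase_unitary T \<theta> \<in> carrier_mat n n"
    using T by (intro phase_unitary_carrier) (simp add: hermitian_mat_def)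
  have D: "phase_channel T \<theta> = (\<lambda>X. phase_unitary T \<theta> * X * mat_adjoint (phase_unitary T \<theta>))"
    by (rule ext) (rule phase_channel_conj[OF T])
  have F: "0 \<le> F" "F \<le> sqrt s"
    using channel_fidelity_bounds[OF C V v D] by (auto simp: F_def s_def u_def)
  have "density_operator n (C (pure_state v))"
    by (rule channel_density[OF C density_pure_state[OF v]])
  then have \<sigma>: "psd_mat n (C (pure_state v))" "mat_trace (C (pure_state v)) = 1"
    by (auto simp: density_operator_def)
  have u: "u \<in> carrier_vec n" "u \<bullet>c u = 1" using V v unit by (auto simp: u_def)
  have s: "0 \<le> s" "s \<le> 1"
    using \<sigma> u sandwich_le_trace[OF \<sigma>(1) u] by (auto simp: s_def psd_mat_iff less_eq_complex_def)
  have F1: "F \<le> 1" using F(2) s real_sqrt_le_1_iff[of s] by linarith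
  \<comment> \<open>\<open>F1\<close> is what lets the square undo the root: for a negative radicand
    \<open>sqrt\<close> would return a negative number and the square would change sign.\<close>
  have x: "x = 1 - F" using F1 by (simp add: x_def bures_distance_def F_def[symmetric])
  show "0 \<le> x" "x \<le> 1" using F(1) F1 x by auto
  have "F\<^sup>2 \<le> (sqrt s)\<^sup>2" using F by (intro power_mono) auto
  then have "F\<^sup>2 \<le> s" using s by simp
  moreover have "1 - 2 * x \<le> F\<^sup>2"
  proof -
    have "F\<^sup>2 = 1 - 2 * x + x\<^sup>2" unfolding x by (simp add: power2_eq_square algebra_simps)
    then show ?thesis by simp
  qed
  ultimately show "1 - 2 * x \<le> Re (sandwich (C (pure_state v)) (phase_unitary T \<theta> *\<^sub>v v) (phase_unitary T \<theta> *\<^sub>v v))"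
    by (simp add: s_def u_def)
qed

lemma phase_unitary_orthonormal_combination:
  assumes T: "hermitian_mat n T"
    and v: "v \<in> carrier_vec n" "T *\<^sub>v v = complex_of_real a \<cdot>\<^sub>v v"
    and w: "w \<in> carrier_vec n" "T *\<^sub>v w = complex_of_real b \<cdot>\<^sub>v w"
  shows "phase_unitary T \<theta> *\<^sub>v (c \<cdot>\<^sub>v v + d \<cdot>\<^sub>v w)
    = (c * cis (- (\<theta> * a))) \<cdot>\<^sub>v v + (d * cis (- (\<theta> * b))) \<cdot>\<^sub>v w"
proof -
  have V: "phase_unitary T \<theta> \<in> carrier_mat n n"
    using T by (intro phase_unitary_carrier) (simp add: hermitian_mat_def)
  show ?thesis
    using V v(1) w(1) phase_unitary_eigenvector[OF T v] phase_unitary_eigenvector[OF T w]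
    by (simp add: mult_add_distrib_mat_vec[of _ n n] mult_mat_vec[of _ n n] smult_smult_assoc)
qed

text \<open>For \<open>\<theta> = 2 * pi\<close> this is the integrality of the eigenvalues of the
  generator of a representation of U(1).\<close>

lemma phase_unitary_period:
  assumes T: "hermitian_mat n T" and per: "phase_unitary T \<theta> = phase_unitary T 0"
    and v: "v \<in> carrier_vec n" "v \<bullet>c v = 1" "T *\<^sub>v v = complex_of_real a \<cdot>\<^sub>v v"
  shows "cis (\<theta> * a) = 1"
proof -
  have "cis (- (\<theta> * a)) \<cdot>\<^sub>v v = 1 \<cdot>\<^sub>v v"
    using phase_unitary_eigenvector[OF T v(1,3), of \<theta>] phase_unitary_eigenvector[OF T v(1,3), of 0]
    by (simp add: per)
  then have "cis (- (\<theta> * a)) * (v \<bullet>c v) = 1 * (v \<bullet>c v)"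
    using v(1) by (metis carrier_vec_conjugate smult_scalar_prod_distrib)
  then have "cis (- (\<theta> * a)) = 1" using v(2) by simp
  then have "cnj (cis (\<theta> * a)) = 1" by (simp add: cis_cnj)
  then show ?thesis by (metis complex_cnj_cnj complex_cnj_one)
qed

theorem lemma1:
  fixes n :: nat and T :: "complex mat"
    and R :: "complex \<Rightarrow> complex mat"
    and C :: "real \<Rightarrow> complex mat \<Rightarrow> complex mat"
  assumes "n > 0"
    and "hermitian_mat n T"
    and "unitary_rep_U1 n R"
    and "\<And>\<theta>. R (cis \<theta>) = phase_unitary T \<theta>"
    and "\<And>\<theta>. \<theta> \<in> {0..2 * pi} \<Longrightarrow> channel n (C \<theta>)"
    and "\<And>\<theta> \<rho>. \<theta> \<in> {0..2 * pi} \<Longrightarrow> density_operator n \<rho> \<Longrightarrow>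
           \<exists>D. has_mat_derivative n (\<lambda>t. C t \<rho>) D (at \<theta> within {0..2 * pi})"
    and "\<And>\<rho>. density_operator n \<rho> \<Longrightarrow> C 0 \<rho> = C (2 * pi) \<rho>"
  shows "Sup {ereal q | q \<rho> \<theta>. density_operator n \<rho> \<and> \<theta> \<in> {0..2 * pi} \<and>
                 has_qfi n (\<lambda>t. C t \<rho>) {0..2 * pi} \<theta> q}
         \<ge> ereal ((INF \<theta>\<in>{0..2 * pi}. 1 - 8 * (bures_distance n (C \<theta>) (phase_channel T \<theta>))\<^sup>2)
                    * (eigenvalue_spread T)\<^sup>2)"
proof -
  note T = assms(2)
  note C = assms(5)
  let ?I = "{0..2 * pi}"
  define d2 where "d2 = (\<lambda>\<theta>. (bures_distance n (C \<theta>) (phase_channel T \<theta>))\<^sup>2)"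
  define M where "M = (INF \<theta>\<in>?I. 1 - 8 * d2 \<theta>)"
  define Q where "Q = {ereal q | q \<rho> \<theta>. density_operator n \<rho> \<and> \<theta> \<in> ?I \<and>
                 has_qfi n (\<lambda>t. C t \<rho>) ?I \<theta> q}"
  obtain a b v w where spread: "eigenvalue_spread T = a - b" "a \<ge> b"
    and v: "v \<in> carrier_vec n" "v \<bullet>c v = 1" "T *\<^sub>v v = of_real a \<cdot>\<^sub>v v"
    and w: "w \<in> carrier_vec n" "w \<bullet>c w = 1" "T *\<^sub>v w = of_real b \<cdot>\<^sub>v w"
    using eigenvalue_spread_eigenvectors[OF T assms(1)] by blast
  have psd: "psd_mat n (C t \<rho>)" and tr: "mat_trace (C t \<rho>) = 1" if "t \<in> ?I" "density_operator n \<rho>" for t \<rho>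
    using channel_density[OF C[OF that(1)] that(2)] by (auto simp: density_operator_def)
  have "\<exists>q. ereal q \<in> Q \<and> M * (a - b)\<^sup>2 \<le> q"
  proof (cases "M > 0 \<and> a > b")
    \<comment> \<open>The right-hand side is at most 0, so any Fisher information will do. The
      parameter \<open>pi\<close> is an interior point, where one exists, and \<open>K = 0\<close>
      in the variational bound shows that it is nonnegative.\<close>
    case False
    then have le: "M * (a - b)\<^sup>2 \<le> 0"
      using spread(2) by (auto simp: not_less mult_nonpos_nonneg)
    have \<rho>: "density_operator n (pure_state v)" using v by (simp add: density_pure_state)
    obtain D where D: "has_mat_derivative n (\<lambda>t. C t (pure_state v)) D (at pi within ?I)"
      using assms(6)[OF _ \<rho>, of pi] by auto
    have "hermitian_mat n (0\<^sub>m n n)" by (rule hermitian_matI) auto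
    moreover obtain q where q: "has_qfi n (\<lambda>t. C t (pure_state v)) ?I pi q"
      and var: "\<forall>K. hermitian_mat n K \<longrightarrow> 2 * Re (mat_trace (D * K)) - Re (mat_trace (C pi (pure_state v) * (K * K))) \<le> q"
      using qfi_variational_bound[OF psd[OF _ \<rho>] _ _ D] by auto
    ultimately have "2 * Re (mat_trace (D * 0\<^sub>m n n)) - Re (mat_trace (C pi (pure_state v) * (0\<^sub>m n n * 0\<^sub>m n n))) \<le> q"
      by blast
    moreover have "D \<in> carrier_mat n n" using D by (simp add: has_mat_derivative_def)
    moreover have "C pi (pure_state v) \<in> carrier_mat n n" using psd[OF _ \<rho>, of pi] psd_mat_carrier by auto
    ultimately have "0 \<le> q"
      by (simp add: right_mult_zero_mat[of _ n n] mat_trace_def)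
    moreover have "ereal q \<in> Q" unfolding Q_def using q \<rho> by (intro CollectI exI conjI) (auto simp: pi_ge_zero)
    ultimately show ?thesis using le by (intro exI[of _ q]) auto
  next
    case True
    then have M0: "M > 0" and ab: "a > b" by auto
    have vw: "v \<bullet>c w = 0"
      using hermitian_eigenvectors[OF T v(1,3) w(1,3)] ab by simp
    \<comment> \<open>Equal weights give the ideal output a coherence of modulus 1/2, the value for
      which the final estimate yields the full \<open>(a - b)\<^sup>2\<close>.\<close>
    define h where "h = complex_of_real (sqrt (1 / 2))"
    have hh: "h * h = 1 / 2" "cnj h = h" "cmod h ^ 2 = 1 / 2"
      by (simp_all add: h_def power2_eq_square flip: of_real_mult)
    define \<psi> where "\<psi> = h \<cdot>\<^sub>v v + h \<cdot>\<^sub>v w"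
    have \<psi>: "\<psi> \<in> carrier_vec n" "\<psi> \<bullet>c \<psi> = 1"
      using v w vw by (auto simp: \<psi>_def hh(1,2) intro!: orthonormal_combination_norm)
    define \<rho> where "\<rho> = pure_state \<psi>"
    have \<rho>: "density_operator n \<rho>" using \<psi> by (simp add: \<rho>_def density_pure_state)
    define c where "c = (\<lambda>t. sandwich (C t \<rho>) v w)"
    \<comment> \<open>The phase undoes the ideal rotation: if \<open>C t\<close> were the ideal
      channel, \<open>g\<close> would be constantly 1/2.\<close>
    define g where "g = (\<lambda>t. cis (t * (a - b)) * c t)"
    \<comment> \<open>The overlap of the output with the ideal output is half the populations of
      \<open>v\<close> and \<open>w\<close> plus \<open>Re (g t)\<close>; the relative phase of the
      ideal output is exactly the one in \<open>g\<close>.\<close>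
    have overlap: "1 - 4 * d2 t \<le> 2 * Re (g t)" "0 \<le> d2 t" "d2 t \<le> 1" if t: "t \<in> ?I" for t
    proof -
      let ?c = "h * cis (- (t * a))" and ?d = "h * cis (- (t * b))"
      have u: "phase_unitary T t *\<^sub>v \<psi> = ?c \<cdot>\<^sub>v v + ?d \<cdot>\<^sub>v w"
        unfolding \<psi>_def by (rule phase_unitary_orthonormal_combination[OF T v(1,3) w(1,3)])
      have cc: "cnj (cis x) * cis x = 1" for x by (simp add: cis_cnj cis_mult)
      have "?c * cnj ?c + ?d * cnj ?d = 1"
        using hh cc by (simp add: algebra_simps)
      then have unit: "(phase_unitary T t *\<^sub>v \<psi>) \<bullet>c (phase_unitary T t *\<^sub>v \<psi>) = 1"
        unfolding u using v w vw by (intro orthonormal_combination_norm)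
      note B = bures_distance_square[OF C[OF t] T \<psi> unit]
      show "0 \<le> d2 t" "d2 t \<le> 1" using B by (auto simp: d2_def)
      have p: "psd_mat n (C t \<rho>)" by (rule psd[OF t \<rho>])
      have "cnj ?c * ?d = h * h * (cis (t * a) * cis (- (t * b)))"
        using hh(2) by (simp add: cis_cnj)
      also have "\<dots> = 1 / 2 * cis (t * (a - b))"
        by (simp add: hh(1) cis_mult algebra_simps)
      finally have cd: "cnj ?c * ?d = 1 / 2 * cis (t * (a - b))" .
      have half: "2 * Re (1 / 2 * x * y) = Re (x * y)" for x y by simp
      have "(cmod ?c)\<^sup>2 = 1 / 2" "(cmod ?d)\<^sup>2 = 1 / 2" by (simp_all add: norm_mult hh(3))
      then have "Re (sandwich (C t \<rho>) (?c \<cdot>\<^sub>v v + ?d \<cdot>\<^sub>v w) (?c \<cdot>\<^sub>v v + ?d \<cdot>\<^sub>v w))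
        = 1 / 2 * Re (sandwich (C t \<rho>) v v) + 1 / 2 * Re (sandwich (C t \<rho>) w w) + Re (g t)"
        by (simp only: sandwich_combination[OF psd_mat_hermitian[OF p] v(1) w(1)] cd half g_def c_def)
      then have "1 - 2 * d2 t \<le> 1 / 2 * (Re (sandwich (C t \<rho>) v v) + Re (sandwich (C t \<rho>) w w)) + Re (g t)"
        using B(3) unfolding u d2_def \<rho>_def by (simp add: add_divide_distrib)
      also have "\<dots> \<le> 1 / 2 + Re (g t)"
        using sandwich_pair_le_trace(2)[OF p v(1) w(1) v(2) w(2) vw] tr[OF t \<rho>] by simp
      finally show "1 - 4 * d2 t \<le> 2 * Re (g t)" by simp
    qed
    have M_le: "M \<le> 1 - 8 * d2 t" if "t \<in> ?I" for t
      unfolding M_def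
    proof (rule cINF_lower[OF _ that])
      \<comment> \<open>The bound -7 is \<open>1 - 8 * d2 \<theta>\<close> at the largest possible
        value \<open>d2 \<theta> = 1\<close>.\<close>
      show "bdd_below ((\<lambda>\<theta>. 1 - 8 * d2 \<theta>) ` ?I)"
        using overlap(3) by (intro bdd_belowI[of _ "-7"]) fastforce
    qed
    have "\<forall>t\<in>?I. \<exists>D. has_mat_derivative n (\<lambda>t. C t \<rho>) D (at t within ?I)"
      using assms(6) \<rho> by blast
    then obtain D where D: "\<And>t. t \<in> ?I \<Longrightarrow> has_mat_derivative n (\<lambda>t. C t \<rho>) (D t) (at t within ?I)"
      by metis
    have c': "(c has_vector_derivative sandwich (D t) v w) (at t within ?I)" if t: "t \<in> ?I" for t
      unfolding c_def using has_mat_derivative_sandwich[OF D[OF t] t _ v(1) w(1)] psd[OF _ \<rho>] psd_mat_carrier by blast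
    \<comment> \<open>The product rule with the phase factored out, so that the radial condition on
      \<open>g\<close> can later be divided by it.\<close>
    define g' where "g' = (\<lambda>t. cis (t * (a - b)) * (\<i> * of_real (a - b) * c t + sandwich (D t) v w))"
    have dcis: "((\<lambda>t. cis (t * (a - b))) has_vector_derivative \<i> * of_real (a - b) * cis (t * (a - b))) (at t within ?I)" for t
      unfolding has_vector_derivative_def
      by (rule derivative_eq_intros refl)+ (simp add: fun_eq_iff scaleR_conv_of_real algebra_simps)
    have "(g has_vector_derivative g' t) (at t within ?I)" if t: "t \<in> ?I" for t
      unfolding g_def g'_def using has_vector_derivative_mult[OF dcis c'[OF t]]
      by (simp add: algebra_simps)
    \<comment> \<open>Positivity of \<open>M\<close> forces \<open>d2 t < 1 / 8\<close>, hence
      \<open>2 * Re (g t) > 1 / 2\<close>.\<close>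
    moreover have "Re (g t) > 0" if "t \<in> ?I" for t
      using overlap(1)[OF that] M_le[OF that] M0 by linarith
    \<comment> \<open>The phase closes because both extremal eigenvalues are integers, the coherence
      because the channel family closes up.\<close>
    moreover have "g 0 = g (2 * pi)"
    proof -
      have per: "phase_unitary T (2 * pi) = phase_unitary T 0"
        using assms(4)[of "2 * pi"] assms(4)[of 0] by simp
      have "cis (2 * pi * (a - b)) = cis (2 * pi * a) * cnj (cis (2 * pi * b))"
        by (simp add: cis_cnj cis_mult algebra_simps)
      then have "cis (2 * pi * (a - b)) = 1"
        by (simp add: phase_unitary_period[OF T per v] phase_unitary_period[OF T per w])
      then show ?thesis using assms(7)[OF \<rho>] by (simp add: g_def c_def)
    qed
    ultimately obtain t k where t: "0 < t" "t < 2 * pi" and k: "g' t = of_real k * g t"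
      using radial_derivative_exists[of 0 "2 * pi" g g'] by auto
    have tI: "t \<in> ?I" using t by simp
    have "cis (t * (a - b)) * (\<i> * of_real (a - b) * c t + sandwich (D t) v w) = cis (t * (a - b)) * (of_real k * c t)"
      using k by (simp add: g'_def g_def mult_ac)
    then have "\<i> * of_real (a - b) * c t + sandwich (D t) v w = of_real k * c t"
      by (simp only: mult_cancel_left cis_neq_zero simp_thms)
    then have Dt: "sandwich (D t) v w = c t * (of_real k - \<i> * of_real (a - b))"
      by (simp add: algebra_simps)
    \<comment> \<open>The quadratic bound \<open>4 * Re (z * D) - (cmod z)\<^sup>2\<close>, with
      \<open>D\<close> the matrix element in \<open>Dt\<close>, is maximal at twice the conjugate of
      \<open>D\<close>; \<open>?z\<close> is this optimum with \<open>k\<close> set to 0. The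
      unknown radial rate \<open>k\<close> then enters \<open>?z * D\<close> only through its
      imaginary part.\<close>
    let ?z = "2 * of_real (a - b) * \<i> * cnj (c t)"
    obtain q where q: "has_qfi n (\<lambda>t. C t \<rho>) ?I t q"
      and le: "4 * Re (?z * sandwich (D t) v w) - (cmod ?z)\<^sup>2 \<le> q"
      using qfi_coherence_bound[OF psd[OF _ \<rho>] tr[OF tI \<rho>] t D[OF tI] v(1) w(1) v(2) w(2) vw] by blast
    have "?z * sandwich (D t) v w = of_real (2 * (a - b) * (cmod (c t))\<^sup>2) * (of_real (a - b) + \<i> * of_real k)"
      by (simp add: Dt of_real_cmod_square algebra_simps)
    then have "Re (?z * sandwich (D t) v w) = 2 * (a - b)\<^sup>2 * (cmod (c t))\<^sup>2"
      by (simp only: times_complex.sel) (simp add: power2_eq_square)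
    moreover have "(cmod ?z)\<^sup>2 = 4 * (a - b)\<^sup>2 * (cmod (c t))\<^sup>2"
      by (simp add: norm_mult power_mult_distrib flip: of_real_diff)
    ultimately have q_ge: "(2 * cmod (c t))\<^sup>2 * (a - b)\<^sup>2 \<le> q" using le by (simp add: power_mult_distrib mult_ac)
    have "1 - 4 * d2 t \<le> 2 * cmod (c t)"
    proof -
      have "Re (g t) \<le> cmod (g t)" by (rule complex_Re_le_cmod)
      also have "cmod (g t) = cmod (c t)" by (simp add: g_def norm_mult)
      finally show ?thesis using overlap(1)[OF tI] by linarith
    qed
    \<comment> \<open>Squaring needs this sign; it follows from \<open>d2 t < 1 / 8\<close>. The 8
      of the claim is the linear term of the square, and the remaining
      \<open>(4 * d2 t)\<^sup>2\<close> is discarded.\<close>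
    moreover have "0 \<le> 1 - 4 * d2 t" using M_le[OF tI] M0 overlap(2)[OF tI] by linarith
    ultimately have "(1 - 4 * d2 t)\<^sup>2 \<le> (2 * cmod (c t))\<^sup>2" by (rule power_mono)
    moreover have "(1 - 4 * d2 t)\<^sup>2 = 1 - 8 * d2 t + (4 * d2 t)\<^sup>2"
      by (simp add: power2_eq_square algebra_simps)
    ultimately have "M \<le> (2 * cmod (c t))\<^sup>2"
      using M_le[OF tI] zero_le_power2[of "4 * d2 t"] by linarith
    then have "M * (a - b)\<^sup>2 \<le> (2 * cmod (c t))\<^sup>2 * (a - b)\<^sup>2" by (rule mult_right_mono) simp
    then have "M * (a - b)\<^sup>2 \<le> q" using q_ge by linarith
    moreover have "ereal q \<in> Q" unfolding Q_def using q \<rho> tI by blast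
    ultimately show ?thesis by blast
  qed
  then obtain q where "ereal q \<in> Q" "M * (a - b)\<^sup>2 \<le> q" by blast
  then have "ereal (M * (a - b)\<^sup>2) \<le> Sup Q"
    by (meson Sup_upper ereal_less_eq(3) order_trans)
  then show ?thesis unfolding Q_def M_def d2_def spread(1) .
qed

end
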